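(* Let $n > 8$ be an integer congruent to one of $2, 10, 16, 20, 22, 26, 28$ modulo $30$, and let $F_n(x)$ denote the characteristic polynomial of the tree $G_{n,3}$. Then $F_n(x)$ is irreducible over $\mathbb{Q}$. In particular, there are infinitely many pairwise non-isomorphic trees whose characteristic polynomial is irreducible over $\mathbb{Q}$.
   Context: For a finite simple graph $G$ with adjacency matrix $A(G)$, the characteristic polynomial of $G$ is $\chi_G(t)=\det(tI-A(G))$. For $n\ge 3$ and $1\le k\le n-1$, $G_{n,k}$ denotes the tree with vertex set $\{1,\dots,n\}$ obtained from the path on the vertices $1,2,\dots,n-1$ (consecutive integers adjacent) by attaching one extra leaf (the vertex $n$) to the vertex $k$. Thus $G_{n,3}$ is the path $1,2,\dots,n-1$ with an extra vertex $n$ adjacent only to vertex $3$. *)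

theory Defs
  imports "Graph_Theory.Graph_Theory" "Jordan_Normal_Form.Char_Poly"
begin

text \<open>
  A finite simple graph is a symmetric, loop-free finite digraph without parallel arcs
  (\<^locale>\<open>pair_graph\<close>): an undirected edge is a pair of opposite arcs.
\<close>

definition path_with_leaf :: "nat \<Rightarrow> nat \<Rightarrow> nat pair_pre_digraph" where
  "path_with_leaf n k =
    (let E = {(i, i + 1) | i. 1 \<le> i \<and> i + 1 \<le> n - 1} \<union> {(k, n)}
     in \<lparr> pverts = {1..n}, parcs = E \<union> E\<inverse> \<rparr>)"

text \<open>
  Graph Theory's own \<^const>\<open>forest\<close> and \<^const>\<open>tree\<close> count the closed walk \<open>u, v, u\<close> along the
  two arcs of one edge as a cycle, so no symmetric digraph with an edge is a \<^const>\<open>tree\<close> in that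
  sense.  A cycle of an undirected simple graph has at least three edges.
\<close>

definition graph_tree :: "'a pair_pre_digraph \<Rightarrow> bool" where
  "graph_tree G \<longleftrightarrow>
     pair_graph G \<and>
     Digraph_Component.connected (with_proj G) \<and>
     \<not> (\<exists>p. pre_digraph.cycle (with_proj G) p \<and> 3 \<le> length p)"

definition graph_isomorphic :: "'a pair_pre_digraph \<Rightarrow> 'b pair_pre_digraph \<Rightarrow> bool" where
  "graph_isomorphic G H \<longleftrightarrow> digraph_iso (with_proj G) (with_proj H)"

lemma graph_isomorphic_iff:
  assumes "pair_wf_digraph G" "pair_wf_digraph H"
  shows "graph_isomorphic G H \<longleftrightarrow>
    (\<exists>f. bij_betw f (pverts G) (pverts H) \<and>
         (\<forall>u\<in>pverts G. \<forall>v\<in>pverts G. (u, v) \<in> parcs G \<longleftrightarrow> (f u, f v) \<in> parcs H))"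
    (is "?L \<longleftrightarrow> ?R")
proof -
  interpret G: pair_wf_digraph G by fact
  interpret H: pair_wf_digraph H by fact
  show ?thesis
  proof
    assume ?L
    then obtain h where h: "pre_digraph.digraph_isomorphism (with_proj G) h"
      and eq: "with_proj H = app_iso h (with_proj G)"
      unfolding graph_isomorphic_def digraph_iso_def by blast
    let ?f = "iso_verts h"
    have vs: "pverts H = ?f ` pverts G" and as: "parcs H = iso_arcs h ` parcs G"
      and th: "iso_tail h = fst" "iso_head h = snd"
      using eq by (simp_all add: with_proj_def app_iso_def)
    have inj: "inj_on ?f (pverts G)"
      using h by (simp add: pre_digraph.digraph_isomorphism_def)
    have arc: "iso_arcs h (a, b) = (?f a, ?f b)" if "(a, b) \<in> parcs G" for a b
      using h that by (auto simp: pre_digraph.digraph_isomorphism_def th prod_eq_iff)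
    have "(u, v) \<in> parcs G \<longleftrightarrow> (?f u, ?f v) \<in> parcs H"
      if uv: "u \<in> pverts G" "v \<in> pverts G" for u v
    proof
      assume "(u, v) \<in> parcs G"
      then show "(?f u, ?f v) \<in> parcs H"
        using arc[of u v] by (metis as imageI)
    next
      assume "(?f u, ?f v) \<in> parcs H"
      then obtain a b where ab: "(a, b) \<in> parcs G" "iso_arcs h (a, b) = (?f u, ?f v)"
        unfolding as by (metis imageE surj_pair)
      then have "?f a = ?f u" "?f b = ?f v"
        using arc by auto
      then have "a = u" "b = v"
        using inj uv G.in_arcsD1[OF ab(1)] G.in_arcsD2[OF ab(1)] by (auto dest: inj_onD)
      then show "(u, v) \<in> parcs G"
        using ab by simp
    qed
    then show ?R
      using inj vs by (auto simp: bij_betw_def)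
  next
    assume ?R
    then obtain f where inj: "inj_on f (pverts G)" and im: "f ` pverts G = pverts H"
      and iff: "\<And>u v. u \<in> pverts G \<Longrightarrow> v \<in> pverts G \<Longrightarrow>
                  (u, v) \<in> parcs G \<longleftrightarrow> (f u, f v) \<in> parcs H"
      by (auto simp: bij_betw_def)
    define h where "h = \<lparr> iso_verts = f, iso_arcs = map_prod f f, iso_head = snd, iso_tail = fst \<rparr>"
    have "parcs G \<subseteq> pverts G \<times> pverts G"
      by (auto dest: G.in_arcsD1 G.in_arcsD2)
    then have "inj_on (map_prod f f) (parcs G)"
      using map_prod_inj_on[OF inj inj] by (rule inj_on_subset[rotated])
    then have "pre_digraph.digraph_isomorphism (with_proj G) h"
      unfolding pre_digraph.digraph_isomorphism_def h_def
      using inj by (auto simp: wf_digraph_wp_iff assms(1))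
    moreover have "map_prod f f ` parcs G = parcs H"
    proof -
      have "(a, b) \<in> map_prod f f ` parcs G" if ab: "(a, b) \<in> parcs H" for a b
      proof -
        obtain u v where "u \<in> pverts G" "v \<in> pverts G" "a = f u" "b = f v"
          using H.in_arcsD1[OF ab] H.in_arcsD2[OF ab] im by blast
        then show ?thesis
          using ab iff by (auto intro!: rev_image_eqI)
      qed
      moreover have "(f a, f b) \<in> parcs H" if "(a, b) \<in> parcs G" for a b
        using that iff[OF G.in_arcsD1[OF that] G.in_arcsD2[OF that]] by simp
      ultimately show ?thesis
        by auto
    qed
    then have "with_proj H = app_iso h (with_proj G)"
      unfolding app_iso_def h_def by (simp add: im with_proj_def)
    ultimately show ?L
      unfolding graph_isomorphic_def digraph_iso_def by blast
  qed
qed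

text \<open>
  Rows and columns are indexed by the vertices in increasing order; another enumeration
  conjugates the matrix by a permutation and leaves the characteristic polynomial unchanged.
\<close>

definition adjacency_matrix :: "'a::linorder pair_pre_digraph \<Rightarrow> 'b::zero_neq_one mat" where
  "adjacency_matrix G =
    (let vs = sorted_list_of_set (pverts G)
     in mat (length vs) (length vs) (\<lambda>(i, j). if (vs ! i, vs ! j) \<in> parcs G then 1 else 0))"

definition graph_char_poly :: "'a::linorder pair_pre_digraph \<Rightarrow> rat poly" where
  "graph_char_poly G = char_poly (adjacency_matrix G)"

end

theory Submission
  imports Defs "Berlekamp_Zassenhaus.Factor_Bound"
begin

text \<open>
  Write \<open>F\<close> for the characteristic polynomial.  Under \<open>x = z + 1 / z\<close>, \<open>w = z\<^sup>2\<close> it becomes, up to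
  trivial factors, the Coxeter polynomial of \<open>E\<^sub>n\<close>, that is
  \<open>w\<^bsup>n - 2\<^esup> (w\<^sup>3 - w - 1) + (w\<^sup>3 + w\<^sup>2 - 1)\<close>.
  By interlacing with the paths obtained by deleting vertex 3, all roots of \<open>F\<close> are real and at most
  one of them, a simple one, exceeds 2.  A factor with all its roots in \<open>[-2, 2]\<close> would by Kronecker's
  theorem give a root of unity \<open>w\<close> on which the Coxeter polynomial vanishes.  Applying a Galois conjugation
  \<open>w \<mapsto> w\<^sup>2\<close>, \<open>-w\<close> or \<open>-w\<^sup>2\<close> and eliminating \<open>w\<^bsup>n - 2\<^esup>\<close> leaves equations that do not depend on \<open>n\<close>,
  which force \<open>w\<close> to have order 3, 5, 12 or 30 and \<open>n\<close> to lie in an excluded residue class.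
  As \<open>F\<close> is even, the only factorisation left is \<open>F(x) = \<plusminus> p(x) p(-x)\<close>, and this is impossible by
  looking at the coefficients of \<open>x\<^bsup>n - 2\<^esup>\<close> and \<open>x\<^bsup>n - 4\<^esup>\<close> modulo 4.
\<close>

hide_const (open) up_ring.coeff up_ring.monom module.smult comm_monoid_mult_class.coprime

section \<open>Integer polynomials and Kronecker's theorem\<close>

abbreviation cpoly :: "int poly \<Rightarrow> complex \<Rightarrow> complex" where
  "cpoly p \<equiv> poly (map_poly of_int p)"

lemma cpoly_hom:
  "cpoly (p + q) x = cpoly p x + cpoly q x"
  "cpoly (p - q) x = cpoly p x - cpoly q x"
  "cpoly (- p) x = - cpoly p x"
  "cpoly (p * q) x = cpoly p x * cpoly q x"
  "cpoly (smult c p) x = of_int c * cpoly p x"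
  "cpoly (p ^ n) x = cpoly p x ^ n"
  by (simp_all add: of_int_poly_hom.hom_add of_int_poly_hom.hom_minus of_int_poly_hom.hom_uminus
      of_int_poly_hom.hom_mult of_int_hom.map_poly_hom_smult of_int_poly_hom.hom_power)

text \<open>Subtracting a monomial multiple of \<open>g\<close> cancels the top term without
  dividing coefficients, so remainders of integer polynomials stay integral, as the arguments below
  need.\<close>

lemma exists_monic_remainder:
  fixes f g :: "'a::comm_ring_1 poly"
  assumes "monic g" "degree g > 0"
  shows "\<exists>q r. f = g * q + r \<and> degree r < degree g"
proof (induction "degree f" arbitrary: f rule: less_induct)
  case less
  show ?case
  proof (cases "degree f < degree g")
    case True
    then have "f = g * 0 + f \<and> degree f < degree g" by simp
    then show ?thesis by blast
  next
    case False
    define m where "m = monom (lead_coeff f) (degree f - degree g)"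
    define f' where "f' = f - g * m"
    have le: "degree (g * m) \<le> degree f"
      using False degree_mult_le[of g m] degree_monom_le[of "lead_coeff f" "degree f - degree g"]
      unfolding m_def by linarith
    have "coeff (g * m) (degree f) = lead_coeff f"
      using False assms(1) by (simp add: m_def mult.commute[of g] coeff_monom_mult)
    then have "coeff f' (degree f) = 0"
      by (simp add: f'_def)
    moreover have "degree f' \<le> degree f"
      using le unfolding f'_def by (simp add: degree_diff_le)
    ultimately have "degree f' < degree f"
      using False assms(2) by (metis degree_0 gr_zeroI le_zero_eq leading_coeff_0_iff linorder_neqE_nat not_less)
    then obtain q r where "f' = g * q + r" "degree r < degree g"
      using less by blast
    then have "f = g * (m + q) + r \<and> degree r < degree g"
      by (simp add: f'_def algebra_simps)
    then show ?thesis by blast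
  qed
qed

text \<open>By Gauss's lemma \<open>p\<close> stays irreducible over the rationals. If it did not
  divide \<open>q\<close> there, Bezout coefficients would give \<open>1 = a * p + b * q\<close>,
  which fails at \<open>x\<close>.\<close>

lemma dvd_if_common_root:
  assumes irr: "irreducible\<^sub>d p" and mon: "monic p"
    and "cpoly p x = 0" "cpoly q x = 0"
  shows "p dvd q"
proof -
  let ?r = "map_poly rat_of_int"
  let ?c = "map_poly (of_rat :: rat \<Rightarrow> complex)"
  have cr: "?c (?r f) = map_poly of_int f" for f
    by (subst map_poly_map_poly) (auto simp: o_def)
  interpret c: map_poly_idom_hom "of_rat :: rat \<Rightarrow> complex" ..
  have irr': "irreducible (?r p)"
    using irreducible\<^sub>d_int_rat[OF irr] by simp
  have "?r p dvd ?r q"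
  proof (rule ccontr)
    assume "\<not> ?r p dvd ?r q"
    then have "gcd (?r p) (?r q) = 1"
      by (intro coprime_imp_gcd_eq_1 prime_elem_imp_coprime irreducible_imp_prime_elem irr')
    then obtain a b where ab: "a * ?r p + b * ?r q = 1"
      using bezout_coefficients_fst_snd[of "?r p" "?r q"] by auto
    have "?c (a * ?r p + b * ?r q) = ?c a * map_poly of_int p + ?c b * map_poly of_int q"
      by (simp add: c.hom_add c.hom_mult cr)
    then have "poly (?c a * map_poly of_int p + ?c b * map_poly of_int q) x = 1"
      unfolding ab by simp
    then show False using assms by simp
  qed
  \<comment> \<open>Back to the integers: the remainder modulo the monic \<open>p\<close> is
    divisible by \<open>p\<close> over the rationals and has smaller degree, so it vanishes.\<close>
  obtain s r where sr: "q = p * s + r" "degree r < degree p"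
    using exists_monic_remainder[OF mon] irr by blast
  have "?r p dvd ?r r"
    using \<open>?r p dvd ?r q\<close> unfolding sr(1)
    by (simp add: of_int_poly_hom.hom_add of_int_poly_hom.hom_mult dvd_add_right_iff)
  then have "?r r = 0"
    using sr(2) dvd_imp_degree_le[of "?r p" "?r r"] by fastforce
  then have "r = 0" by simp
  then show ?thesis using sr by simp
qed

lemma monic_int_factor_sign:
  fixes p q :: "int poly"
  assumes "monic (p * q)"
  shows "lead_coeff p = 1 \<and> lead_coeff q = 1 \<or> lead_coeff p = -1 \<and> lead_coeff q = -1"
  using assms by (auto simp: lead_coeff_mult zmult_eq_1_iff)

lemma exists_monic_irreducible_factor:
  fixes f :: "int poly"
  assumes "monic f" "cpoly f x = 0"
  shows "\<exists>p. monic p \<and> irreducible\<^sub>d p \<and> p dvd f \<and> cpoly p x = 0"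
  using assms
proof (induction "degree f" arbitrary: f rule: less_induct)
  case less
  have "degree f > 0"
    using less.prems monic_degree_0[of f] by (cases "degree f = 0") auto
  show ?case
  proof (cases "irreducible\<^sub>d f")
    case True
    then show ?thesis using less.prems by (intro exI[of _ f]) simp
  next
    case False
    then have "\<exists>q r. degree q < degree f \<and> degree r < degree f \<and> f = q * r"
      using \<open>degree f > 0\<close> unfolding irreducible\<^sub>d_def by blast
    then obtain q r where qr: "degree q < degree f" "degree r < degree f" "f = q * r"
      by blast
    \<comment> \<open>The common leading coefficient is 1 or -1; multiplying both factors by it
      makes them monic and preserves the product.\<close>
    define c where "c = lead_coeff q"
    have c: "c * c = 1" "c = lead_coeff r"
      using monic_int_factor_sign[of q r] less.prems qr(3) by (auto simp: c_def)
    have f: "f = smult c q * smult c r" using qr(3) c by simp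
    have mon: "monic (smult c q)" "monic (smult c r)"
      using c by (auto simp: c_def)
    have "cpoly (smult c q) x = 0 \<or> cpoly (smult c r) x = 0"
      using less.prems(2) unfolding f cpoly_hom by simp
    moreover have "degree (smult c q) < degree f" "degree (smult c r) < degree f"
      using qr by (auto intro: le_less_trans degree_smult_le)
    moreover have "smult c q dvd f" "smult c r dvd f" using dvd_triv_left dvd_triv_right f by metis+
    ultimately show ?thesis
      using less.hyps mon by (meson dvd_trans)
  qed
qed

lemma monic_int_monic_cofactor:
  fixes p q :: "int poly"
  assumes "monic p" "monic (p * q)"
  shows "monic q"
  using monic_int_factor_sign[OF assms(2)] assms(1) by auto

lemma exists_complex_root:
  fixes f :: "int poly"
  assumes "degree f > 0"
  shows "\<exists>x. cpoly f x = 0"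
  using fundamental_theorem_of_algebra[of "map_poly of_int f"] assms
  by (simp add: constant_degree)

text \<open>A double zero would be shared with the derivative, so \<open>p\<close> would divide a
  nonzero polynomial of smaller degree.\<close>

lemma irreducible_imp_rsquarefree:
  assumes "irreducible\<^sub>d p" "monic p"
  shows "rsquarefree (map_poly of_int p :: complex poly)"
  unfolding rsquarefree_roots
proof (intro allI notI)
  fix x assume *: "cpoly p x = 0 \<and> poly (pderiv (map_poly of_int p)) x = 0"
  have "pderiv (map_poly of_int p) = (map_poly of_int (pderiv p) :: complex poly)"
    by (intro poly_eqI) (simp add: coeff_pderiv)
  with * have "cpoly p x = 0" "cpoly (pderiv p) x = 0" by auto
  then have "p dvd pderiv p"
    by (rule dvd_if_common_root[OF assms])
  moreover have "degree p > 0" using assms(1) by auto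
  ultimately show False
    by simp
qed

lemma card_roots_irreducible:
  assumes "irreducible\<^sub>d p" "monic p"
  shows "card {x. cpoly p x = 0} = degree p"
proof -
  let ?p = "map_poly of_int p :: complex poly"
  have "degree (smult (lead_coeff ?p) (\<Prod>z|poly ?p z = 0. [:-z, 1:])) = degree ?p"
    using complex_poly_decompose_rsquarefree[OF irreducible_imp_rsquarefree[OF assms]] by simp
  moreover have "?p \<noteq> 0" using assms by auto
  ultimately show ?thesis
    by (simp add: degree_prod_sum_eq)
qed

text \<open>By Lagrange interpolation, the coefficients are linear forms in the values.\<close>

lemma coeff_bound_from_values:
  fixes S :: "complex set"
  assumes "finite S"
  shows "\<exists>B. \<forall>r. degree r < card S \<longrightarrow> (\<forall>s\<in>S. cmod (poly r s) \<le> 2) \<longrightarrow> (\<forall>i. cmod (coeff r i) \<le> B)"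
proof -
  \<comment> \<open>The Lagrange basis on \<open>S\<close>; the 2 in \<open>B\<close> is the assumed
    bound on the values.\<close>
  define L where "L s = (\<Prod>t\<in>S-{s}. smult (1/(s-t)) [:-t,1:])" for s
  define B where "B = (\<Sum>s\<in>S. \<Sum>i\<le>card S. 2 * cmod (coeff (L s) i))"
  have L: "poly (L s) t = (if t = s then 1 else 0)" if "s \<in> S" "t \<in> S" for s t
  proof (cases "t = s")
    case True
    have "poly (L s) s = (\<Prod>t\<in>S-{s}. 1)"
      unfolding L_def poly_prod by (intro prod.cong) (auto simp: field_simps)
    then show ?thesis using True by simp
  next
    case False
    then show ?thesis using that assms unfolding L_def poly_prod
      by (auto intro!: prod_zero bexI[of _ t])
  qed
  have dL: "degree (L s) < card S" if "s \<in> S" for s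
  proof -
    have "degree (L s) \<le> (\<Sum>t\<in>S-{s}. degree (smult (1/(s-t)) [:-t,1:]))"
      unfolding L_def using degree_prod_sum_le[of "S - {s}" "\<lambda>t. smult (1/(s-t)) [:-t,1:]"] assms
      by (simp add: o_def)
    also have "\<dots> \<le> (\<Sum>t\<in>S-{s}. 1)" by (intro sum_mono) auto
    also have "\<dots> < card S" using card_Diff1_less[OF assms that] by simp
    finally show ?thesis .
  qed
  have "cmod (coeff r i) \<le> B" if r: "degree r < card S" "\<forall>s\<in>S. cmod (poly r s) \<le> 2" for r i
  proof -
    \<comment> \<open>The interpolation error has degree below \<open>card S\<close> and vanishes on
      all of \<open>S\<close>, hence is zero.\<close>
    define d where "d = r - (\<Sum>s\<in>S. smult (poly r s) (L s))"
    have "degree (\<Sum>s\<in>S. smult (poly r s) (L s)) < card S"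
      using r(1) dL assms by (intro degree_sum_less) (auto intro: le_less_trans[OF degree_smult_le])
    then have "degree d < card S" unfolding d_def using r(1) by (simp add: degree_diff_less)
    moreover have "poly d t = 0" if "t \<in> S" for t
    proof -
      have "(\<Sum>s\<in>S. poly r s * poly (L s) t) = (\<Sum>s\<in>S. if s = t then poly r s else 0)"
        using L that by (intro sum.cong) auto
      then show ?thesis using that assms by (simp add: d_def poly_sum)
    qed
    ultimately have "d = 0"
      using card_poly_roots_bound[of d] card_mono[OF poly_roots_finite[of d], of S] by (cases "d = 0") auto
    then have "coeff r i = (\<Sum>s\<in>S. poly r s * coeff (L s) i)"
      by (metis (no_types, lifting) coeff_smult coeff_sum d_def eq_iff_diff_eq_0 sum.cong)
    show ?thesis
    proof (cases "i \<le> card S")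
      case True
      have "cmod (coeff r i) \<le> (\<Sum>s\<in>S. cmod (poly r s * coeff (L s) i))"
        unfolding \<open>coeff r i = _\<close> by (rule norm_sum)
      also have "\<dots> \<le> (\<Sum>s\<in>S. 2 * cmod (coeff (L s) i))"
        using r(2) by (intro sum_mono) (auto simp: norm_mult intro: mult_right_mono)
      also have "\<dots> \<le> B" unfolding B_def
        using True by (intro sum_mono member_le_sum) auto
      finally show ?thesis .
    next
      case False
      then have "coeff r i = 0" using r(1) by (simp add: coeff_eq_0)
      moreover have "B \<ge> 0" unfolding B_def by (intro sum_nonneg) auto
      ultimately show ?thesis by simp
    qed
  qed
  then show ?thesis by blast
qed

lemma finite_int_polys_bounded:
  "finite {r :: int poly. degree r < d \<and> (\<forall>i. \<bar>coeff r i\<bar> \<le> b)}" (is "finite ?A")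
proof -
  have "?A \<subseteq> Poly ` {xs. set xs \<subseteq> {-b..b} \<and> length xs \<le> d}"
  proof
    fix r assume r: "r \<in> ?A"
    have "r = Poly (coeffs r)" by simp
    moreover have "set (coeffs r) \<subseteq> {-b..b}"
    proof
      fix x assume "x \<in> set (coeffs r)"
      then obtain i where "x = coeff r i" by (auto simp: coeffs_def split: if_splits)
      then have "\<bar>x\<bar> \<le> b" using r by blast
      then show "x \<in> {-b..b}" by auto
    qed
    moreover have "length (coeffs r) \<le> d"
      using r by (auto simp: length_coeffs_degree coeffs_def)
    ultimately show "r \<in> Poly ` {xs. set xs \<subseteq> {-b..b} \<and> length xs \<le> d}" by blast
  qed
  then show ?thesis
    by (rule finite_subset) (intro finite_imageI finite_lists_length_le, simp)
qed

text \<open>These are the Dickson polynomials, that is, rescaled Chebyshev polynomials of the first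
  kind, built by \<open>D (k + 2) = x * D (k + 1) - D k\<close>.\<close>

lemma exists_dickson:
  "\<exists>D :: int poly. \<forall>z. z \<noteq> 0 \<longrightarrow> cpoly D (z + 1/z) = z ^ k + (1 / z) ^ k"
proof (induction k rule: induct_nat_012)
  case 0
  show ?case by (intro exI[of _ "[:2:]"]) simp
next
  case 1
  show ?case by (intro exI[of _ "[:0,1:]"]) simp
next
  case (ge2 k)
  then obtain D E where DE:
    "\<forall>z. z \<noteq> 0 \<longrightarrow> cpoly D (z + 1/z) = z ^ k + (1 / z) ^ k"
    "\<forall>z. z \<noteq> 0 \<longrightarrow> cpoly E (z + 1/z) = z ^ Suc k + (1 / z) ^ Suc k" by blast
  then show ?case
  proof (intro exI[of _ "[:0,1:] * E - D"] allI impI)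
    fix z :: complex assume "z \<noteq> 0"
    define y where "y = 1 / z"
    have "z * y = 1" using \<open>z \<noteq> 0\<close> by (simp add: y_def)
    have "cpoly ([:0,1:] * E - D) (z + y) = (z + y) * (z ^ Suc k + y ^ Suc k) - (z ^ k + y ^ k)"
      using DE \<open>z \<noteq> 0\<close> unfolding cpoly_hom y_def by simp
    also have "\<dots> = z ^ Suc (Suc k) + y ^ Suc (Suc k)"
    proof -
      have "(z + y) * (z * a + y * b) - (a + b) = z * (z * a) + y * (y * b)" for a b
      proof -
        have "(z + y) * (z * a + y * b) - (a + b) = z * (z * a) + y * (y * b) + (z * y - 1) * (a + b)"
          by (simp add: algebra_simps)
        then show ?thesis using \<open>z * y = 1\<close> by simp
      qed
      then show ?thesis unfolding power_Suc .
    qed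
    finally show "cpoly ([:0,1:] * E - D) (z + 1 / z) = z ^ Suc (Suc k) + (1 / z) ^ Suc (Suc k)"
      unfolding y_def .
  qed
qed

text \<open>Kronecker's theorem: the polynomials \<open>z ^ k + (1 / z) ^ k\<close> in \<open>z + 1 / z\<close>, reduced modulo
  \<open>p\<close>, have bounded coefficients, so two of them agree.\<close>

lemma kronecker_unit_circle:
  assumes irr: "irreducible\<^sub>d p" and mon: "monic p"
    and circ: "\<And>x. cpoly p x = 0 \<Longrightarrow> \<exists>z. cmod z = 1 \<and> x = z + 1/z"
    and z: "z \<noteq> 0" "cpoly p (z + 1/z) = 0"
  shows "\<exists>N>0. z ^ N = 1"
proof -
  define S where "S = {x. cpoly p x = 0}"
  have cS: "card S = degree p" unfolding S_def by (rule card_roots_irreducible[OF irr mon])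
  have dp: "degree p > 0" using irr by auto
  then have "finite S" using cS by (metis card.infinite less_numeral_extra(3))
  obtain B where B: "\<And>r i. degree r < card S \<Longrightarrow> (\<forall>s\<in>S. cmod (poly r s) \<le> 2) \<Longrightarrow> cmod (coeff r i) \<le> B"
    using coeff_bound_from_values[OF \<open>finite S\<close>] by blast
  have "\<exists>r. degree r < degree p \<and>
    (\<forall>z. z \<noteq> 0 \<longrightarrow> cpoly p (z + 1/z) = 0 \<longrightarrow> cpoly r (z + 1/z) = z ^ k + (1 / z) ^ k)" for k
  proof -
    obtain D where D: "\<forall>z. z \<noteq> 0 \<longrightarrow> cpoly D (z + 1/z) = z ^ k + (1 / z) ^ k"
      using exists_dickson by blast
    obtain q r where "D = p * q + r" "degree r < degree p"
      using exists_monic_remainder[OF mon dp] by blast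
    then show ?thesis using D by (intro exI[of _ r]) (auto simp: cpoly_hom)
  qed
  then obtain r where dr: "\<And>k. degree (r k) < degree p"
    and r: "\<And>k z. z \<noteq> 0 \<Longrightarrow> cpoly p (z + 1/z) = 0 \<Longrightarrow> cpoly (r k) (z + 1/z) = z ^ k + (1 / z) ^ k"
    by metis
  have "r k \<in> {r. degree r < degree p \<and> (\<forall>i. \<bar>coeff r i\<bar> \<le> \<lfloor>B\<rfloor>)}" for k
  proof -
    have "cmod (cpoly (r k) s) \<le> 2" if "s \<in> S" for s
    proof -
      obtain z where z: "cmod z = 1" "s = z + 1/z"
        using circ[of s] \<open>s \<in> S\<close> unfolding S_def by blast
      then have "cpoly (r k) s = z ^ k + (1 / z) ^ k" using r[of z k] that unfolding S_def by force
      also have "cmod \<dots> \<le> cmod (z ^ k) + cmod ((1 / z) ^ k)" by (rule norm_triangle_ineq)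
      also have "\<dots> = 2" using z by (simp add: norm_power norm_divide)
      finally show ?thesis .
    qed
    then have "cmod (of_int (coeff (r k) i)) \<le> B" for i
      using B[of "map_poly of_int (r k)" i] dr[of k] cS by simp
    then show ?thesis using dr by (auto simp: le_floor_iff)
  qed
  then have "finite (range r)"
    by (intro finite_subset[OF _ finite_int_polys_bounded[of "degree p" "\<lfloor>B\<rfloor>"]]) blast
  then have "\<not> inj r" using finite_imageD by blast
  then obtain k l where kl: "k < l" "r k = r l"
    unfolding inj_def by (metis linorder_neqE_nat)
  have *: "z ^ k + (1 / z) ^ k = z ^ l + (1 / z) ^ l"
    using r[OF z, of k] r[OF z, of l] kl by simp
  \<comment> \<open>With \<open>a = z ^ k\<close> and \<open>c = z ^ l\<close>, equality of
    \<open>a + 1 / a\<close> and \<open>c + 1 / c\<close> forces \<open>c = a\<close> or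
    \<open>a * c = 1\<close>.\<close>
  then have "(z ^ l - z ^ k) * (z ^ (k + l) - 1) = 0"
  proof -
    have "z * (1 / z) = 1" using z(1) by simp
    then have "z ^ k * (1 / z) ^ k = 1" "z ^ l * (1 / z) ^ l = 1"
      by (metis power_mult_distrib power_one)+
    moreover have "(c - a) * (a * c - 1) = 0" if "a * b = 1" "c * d = 1" "a + b = c + d" for a b c d :: complex
    proof -
      have "(c - a) * (a * c - 1) = a * c * ((c + d) - (a + b)) + (a * b - 1) * c - (c * d - 1) * a"
        by (simp add: algebra_simps)
      then show ?thesis using that by simp
    qed
    ultimately show ?thesis using * unfolding power_add by blast
  qed
  then have "z ^ (l - k) = 1 \<or> z ^ (k + l) = 1"
    using z(1) kl(1) by (auto simp: power_diff)
  moreover have "l - k > 0" "k + l > 0" using kl(1) by auto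
  ultimately show ?thesis by blast
qed

section \<open>Conjugates of roots of unity\<close>

text \<open>The prime divides all inner binomial coefficients. The error is an explicit multiple of
  \<open>p\<close>, so that the identity can be used in the ring of integer polynomials.\<close>

lemma binomial_power_mod_prime:
  fixes a b :: "'a::comm_ring_1"
  assumes "prime p"
  shows "\<exists>s. (a + b) ^ p = a ^ p + b ^ p + of_nat p * s"
proof -
  have p: "p > 0" using assms prime_gt_0_nat by blast
  define t where "t k = of_nat ((p choose k) div p) * a ^ k * b ^ (p - k)" for k
  have "{..p} = insert 0 (insert p {0<..<p})" using p by auto
  then have "(a + b) ^ p = a ^ p + b ^ p + (\<Sum>k\<in>{0<..<p}. of_nat (p choose k) * a ^ k * b ^ (p - k))"
    using p by (simp add: binomial_ring)
  also have "(\<Sum>k\<in>{0<..<p}. of_nat (p choose k) * a ^ k * b ^ (p - k)) = (\<Sum>k\<in>{0<..<p}. of_nat p * t k)"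
  proof (rule sum.cong)
    fix k assume "k \<in> {0<..<p}"
    then have "p dvd p choose k"
      using assms by (intro dvd_choose_prime) auto
    then have "p choose k = p * ((p choose k) div p)"
      by simp
    then have "(of_nat (p choose k) :: 'a) = of_nat p * of_nat ((p choose k) div p)"
      by (metis of_nat_mult)
    then show "of_nat (p choose k) * a ^ k * b ^ (p - k) = of_nat p * t k"
      unfolding t_def by (simp only: mult.assoc)
  qed simp
  finally show ?thesis by (auto simp: sum_distrib_left[symmetric])
qed

lemma int_power_mod_prime:
  assumes "prime p"
  shows "\<exists>m. (a::int) ^ p = a + int p * m"
proof -
  have nat: "[b ^ p = b] (mod p)" for b :: nat
  proof (cases "p dvd b")
    case True
    moreover from this have "p dvd b ^ p"
      using assms by (metis dvd_trans dvd_power prime_gt_0_nat)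
    ultimately show ?thesis by (simp add: cong_def mod_0_imp_dvd dvd_imp_mod_0)
  next
    case False
    then have "[b ^ (p - 1) * b = 1 * b] (mod p)"
      by (intro cong_mult fermat_theorem assms) auto
    then show ?thesis using assms by (metis mult_1 power_minus_mult prime_gt_0_nat)
  qed
  define b where "b = nat (a mod int p)"
  have "p > 0" using assms prime_gt_0_nat by blast
  then have b: "[int b = a] (mod int p)" by (simp add: b_def cong_def)
  have "[a ^ p = int b ^ p] (mod int p)" using b by (intro cong_pow) (rule cong_sym)
  also have "[int b ^ p = int b] (mod int p)"
    using nat[of b] unfolding cong_int_iff[symmetric] by simp
  also note b
  finally show ?thesis
    by (metis cong_iff_lin cong_sym mult.commute)
qed

lemma cpoly_pCons: "cpoly (pCons a q) x = of_int a + x * cpoly q x"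
  by (simp add: of_int_hom.map_poly_pCons_hom)

text \<open>The Frobenius congruence modulo \<open>p\<close>, by induction on the coefficients:
  Fermat's little theorem handles the constant term and the binomial congruence splits it
  off.\<close>

lemma frobenius_int_poly:
  assumes "prime p"
  shows "\<exists>s. \<forall>x. cpoly q (x ^ p) = cpoly q x ^ p + of_nat p * cpoly s x"
proof (induction q)
  case 0
  have "p > 0" using assms prime_gt_0_nat by blast
  then show ?case by (intro exI[of _ 0]) simp
next
  case (pCons a q)
  then obtain s where s: "\<And>x. cpoly q (x ^ p) = cpoly q x ^ p + of_nat p * cpoly s x" by blast
  obtain t where t: "([:a:] + [:0,1:] * q) ^ p = [:a:] ^ p + ([:0,1:] * q) ^ p + of_nat p * t"
    using binomial_power_mod_prime[OF assms] by blast
  obtain m where m: "a ^ p = a + int p * m" using int_power_mod_prime[OF assms] by blast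
  show ?case
  \<comment> \<open>The three terms are the errors of the induction hypothesis, of the binomial
    congruence and of Fermat's theorem; the last two arise in expanding the right-hand side and so
    change sign.\<close>
  proof (intro exI[of _ "[:0,1:] ^ p * s - t - [:m:]"] allI)
    fix x :: complex
    have "cpoly (pCons a q) x ^ p = cpoly (([:a:] + [:0,1:] * q) ^ p) x"
      by (simp add: cpoly_hom cpoly_pCons)
    also have "\<dots> = of_int a ^ p + (x * cpoly q x) ^ p + of_nat p * cpoly t x"
      unfolding t cpoly_hom by (simp add: cpoly_pCons of_nat_poly)
    also have "(of_int a :: complex) ^ p = of_int a + of_nat p * of_int m"
      using arg_cong[OF m, of "of_int :: int \<Rightarrow> complex"] by simp
    finally have "cpoly (pCons a q) x ^ p =
      of_int a + of_nat p * of_int m + x ^ p * cpoly q x ^ p + of_nat p * cpoly t x"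
      by (simp add: power_mult_distrib)
    then show "cpoly (pCons a q) (x ^ p)
        = cpoly (pCons a q) x ^ p + of_nat p * cpoly ([:0,1:] ^ p * s - t - [:m:]) x"
      unfolding cpoly_pCons cpoly_hom s by (simp add: algebra_simps)
  qed
qed

text \<open>Irreducibility of cyclotomic polynomials in disguise.  If \<open>x ^ k - 1 = h q\<close> with \<open>h\<close>
  the minimal polynomial of \<open>w\<close> and \<open>q(w ^ p) = 0\<close>, then \<open>q(w) ^ p\<close> is divisible by \<open>p\<close>, and so is
  the \<open>p\<close>-th power of \<open>k = w h'(w) q(w)\<close>.\<close>

lemma conjugate_prime_power:
  assumes p: "prime p" "\<not> p dvd k" and k: "k > 0" "w ^ k = 1" and f: "cpoly f w = 0"
  shows "cpoly f (w ^ p) = 0"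
proof -
  define X :: "int poly" where "X = monom 1 k - 1"
  have X: "cpoly X x = x ^ k - 1" for x
    unfolding X_def cpoly_hom by (simp add: map_poly_monom poly_monom)
  have "degree X = k"
    unfolding X_def using k(1) degree_add_eq_left[of "-1" "monom (1::int) k"] by (simp add: degree_monom_eq)
  then have "monic X" using k(1) by (simp add: X_def)
  then obtain h where h: "monic h" "irreducible\<^sub>d h" "h dvd X" "cpoly h w = 0"
    using exists_monic_irreducible_factor[of X w] X k(2) by auto
  obtain q where q: "X = h * q" using h(3) by blast
  have "h dvd f" using dvd_if_common_root[OF h(2,1,4) f] .
  have "cpoly h (w ^ p) = 0"
  proof (rule ccontr)
    assume "cpoly h (w ^ p) \<noteq> 0"
    moreover have "cpoly X (w ^ p) = 0"
    proof -
      have "(w ^ p) ^ k = (w ^ k) ^ p" by (simp add: mult.commute flip: power_mult)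
      then show ?thesis using X k(2) by simp
    qed
    ultimately have "cpoly q (w ^ p) = 0" unfolding q cpoly_hom by simp
    then obtain s where s: "cpoly q w ^ p = - of_nat p * cpoly s w"
      using frobenius_int_poly[OF p(1), of q] by (metis add_eq_0_iff2 mult_minus_left)
    have "pderiv X = monom (int k) (k - 1)" by (simp add: X_def pderiv_diff pderiv_monom)
    then have "monom (int k) (k - 1) = h * pderiv q + q * pderiv h"
      unfolding q by (simp add: pderiv_mult)
    from arg_cong[OF this, of "\<lambda>f. cpoly f w"] h(4)
    have "of_nat k * w ^ (k - 1) = cpoly q w * cpoly (pderiv h) w"
      unfolding cpoly_hom by (simp add: map_poly_monom poly_monom)
    then have "of_nat k * (w ^ (k - 1) * w) = cpoly q w * (cpoly (pderiv h) w * w)"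
      by (simp only: mult.assoc[symmetric])
    moreover have "w ^ (k - 1) * w = 1" using k power_minus_mult by metis
    ultimately have "of_nat k = cpoly q w * (cpoly (pderiv h) w * w)" by (metis mult_1_right)
    then have "of_nat k ^ p = cpoly q w ^ p * (cpoly (pderiv h) w * w) ^ p"
      by (metis power_mult_distrib)
    also have "\<dots> = of_nat p * cpoly (- s * (pderiv h * [:0,1:]) ^ p) w"
      unfolding s cpoly_hom by simp
    finally have kp: "of_nat k ^ p = of_nat p * cpoly (- s * (pderiv h * [:0,1:]) ^ p) w" .
    have dh: "degree h > 0" using h(2) by auto
    obtain u r where ur: "- s * (pderiv h * [:0,1:]) ^ p = h * u + r" "degree r < degree h"
      using exists_monic_remainder[OF h(1) dh] by blast
    \<comment> \<open>This turns divisibility at \<open>w\<close> into divisibility of integers: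
      \<open>d\<close> vanishes at \<open>w\<close> but has degree below its minimal polynomial
      \<open>h\<close>, so \<open>d = 0\<close>, and the constant coefficient yields
      \<open>p dvd k ^ p\<close>.\<close>
    define d where "d = [:int (k ^ p):] - smult (int p) r"
    have "cpoly d w = 0"
      using kp h(4) unfolding ur(1) d_def cpoly_hom by (simp add: cpoly_pCons)
    then have "h dvd d" by (rule dvd_if_common_root[OF h(2,1,4)])
    moreover have "degree d < degree h"
      unfolding d_def using ur(2) dh by (intro degree_diff_less) (auto intro: le_less_trans[OF degree_smult_le])
    ultimately have "d = 0" using dvd_imp_degree_le leD by blast
    then have "int (k ^ p) = int p * coeff r 0"
      unfolding d_def by (metis coeff_0 coeff_diff coeff_pCons_0 coeff_smult eq_iff_diff_eq_0)
    then have "p dvd k ^ p" by (metis dvd_triv_left int_dvd_int_iff)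
    then show False using p prime_dvd_power by blast
  qed
  then show ?thesis using \<open>h dvd f\<close> by (auto simp: cpoly_hom elim!: dvdE)
qed

text \<open>The prime factors of \<open>j\<close> are applied one at a time; none divides
  \<open>k\<close>, and each intermediate power of \<open>w\<close> is again a \<open>k\<close>-th
  root of unity.\<close>

lemma conjugate_coprime_power:
  assumes "coprime j k" "k > 0" "w ^ k = 1" "cpoly f w = 0"
  shows "cpoly f (w ^ j) = 0"
  using assms
proof (induction j arbitrary: w rule: less_induct)
  case (less j)
  consider "j = 0" | "j = 1" | "j > 1" by linarith
  then show ?case
  proof cases
    case 1
    \<comment> \<open>Zero is coprime to \<open>k\<close> only for \<open>k = 1\<close>, and then
      \<open>w = 1\<close>.\<close>
    then show ?thesis using less.prems by (cases "k = 1") auto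
  next
    case 2
    then show ?thesis using less.prems by simp
  next
    case 3
    then obtain p where p: "prime p" "p dvd j" using prime_factor_nat[of j] by auto
    then obtain m where m: "j = p * m" by blast
    have "\<not> p dvd k"
      using less.prems(1) p by (metis coprime_common_divisor not_prime_unit)
    have "cpoly f (w ^ p) = 0"
      by (rule conjugate_prime_power[OF p(1) \<open>\<not> p dvd k\<close> less.prems(2-4)])
    moreover have "m < j" "coprime m k"
      using m 3 prime_gt_1_nat[OF p(1)] less.prems(1) by (cases "m = 0"; simp)+
    moreover have "(w ^ p) ^ k = 1"
      using less.prems(3) by (metis power_mult power_one mult.commute)
    ultimately have "cpoly f ((w ^ p) ^ m) = 0"
      using less.IH less.prems(2) by blast
    then show ?thesis by (simp add: m power_mult)
  qed
qed

section \<open>Cyclotomic factors of Coxeter polynomials\<close>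

lemma power_gcd_eq_1:
  fixes w :: "'a::field"
  assumes "w ^ a = 1" "w ^ b = 1"
  shows "w ^ gcd a b = 1"
  using assms
proof (induction a b rule: gcd_nat_induct)
  case (step a b)
  have "w ^ a = (w ^ b) ^ (a div b) * w ^ (a mod b)"
    by (simp flip: power_mult power_add)
  then have "w ^ (a mod b) = 1" using step.prems by simp
  then show ?case using step.IH step.prems(2) step.hyps by (simp add: gcd_red_nat[of a b])
qed simp

text \<open>This is \<open>w - 1\<close> times the Coxeter polynomial of \<open>E\<^sub>n\<close>.\<close>

definition coxeter_poly :: "nat \<Rightarrow> int poly" where
  "coxeter_poly n = monom 1 (n - 2) * [:-1, -1, 0, 1:] + [:-1, 0, 1, 1:]"

lemma cpoly_coxeter:
  "cpoly (coxeter_poly n) w = w ^ (n - 2) * (w ^ 3 - w - 1) + (w ^ 3 + w ^ 2 - 1)"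
  unfolding coxeter_poly_def cpoly_hom
  by (simp add: map_poly_monom poly_monom cpoly_pCons power2_eq_square power3_eq_cube algebra_simps)

text \<open>This makes \<open>w\<close> and \<open>- w\<close> conjugate when the order
  \<open>k\<close> of \<open>w\<close> is divisible by 4, since \<open>w ^ (k div 2) = - 1\<close>.
  A common divisor divides 2, and the exponent is odd.\<close>

lemma coprime_half_plus_1:
  assumes "4 dvd (k::nat)"
  shows "coprime (k div 2 + 1) k"
proof (rule algebraic_semidom_class.coprimeI)
  fix c assume c: "c dvd k div 2 + 1" "c dvd k"
  have "2 * (k div 2 + 1) = k + 2" using assms by auto
  then have "c dvd k + 2" using c(1) by (metis dvd_mult)
  then have "c dvd 2" using c(2) by (simp only: dvd_add_right_iff)
  then have "c = 1 \<or> c = 2" using two_is_prime_nat by (metis prime_nat_iff)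
  moreover have "odd (k div 2 + 1)" using assms by auto
  ultimately show "is_unit c" using c(1) by auto
qed

text \<open>This makes \<open>w\<close> and \<open>- (w ^ 2)\<close> conjugate when \<open>w\<close>
  has order \<open>2 * l\<close> with \<open>l\<close> odd, since \<open>w ^ l = - 1\<close>. A
  common divisor is odd and divides 4.\<close>

lemma coprime_odd_plus_2:
  assumes "odd (l::nat)"
  shows "coprime (l + 2) (2 * l)"
proof (rule algebraic_semidom_class.coprimeI)
  fix c assume c: "c dvd l + 2" "c dvd 2 * l"
  have "2 * (l + 2) = 2 * l + 4" by simp
  then have "c dvd 2 * l + 4" using c(1) by (metis dvd_mult)
  then have "c dvd 2 ^ 2" using c(2) by (simp add: dvd_add_right_iff)
  moreover have "odd c"
    using c(1) assms dvd_trans[of 2 c "l + 2"] by auto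
  then have "coprime c (2 ^ 2)" unfolding coprime_power_right_iff by simp
  ultimately show "is_unit c" by (metis coprime_absorb_left)
qed

text \<open>The congruence conditions describe exactly the seven admissible residues modulo 30, in
  the form in which the cyclotomic cases use them.\<close>

context
  fixes n :: nat and w :: complex
  assumes n: "n > 8" "even n" "\<not> 3 dvd n" "n mod 5 \<noteq> 4" "n mod 30 \<noteq> 8"
    and root: "w ^ (n - 2) * (w ^ 3 - w - 1) + (w ^ 3 + w ^ 2 - 1) = 0"
begin

text \<open>Vanishing at the indices \<open>n\<close> and \<open>m\<close> determines
  \<open>w ^ (n - 2)\<close> and \<open>w ^ (m - 2)\<close> as the same quotient. Its denominator is
  nonzero, because otherwise the numerator would vanish too and
  \<open>w * (w + 1) = 0\<close>.\<close>

lemma coxeter_root_power: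
  assumes "m \<ge> 2" "m < n" "w ^ (m - 2) * (w ^ 3 - w - 1) + (w ^ 3 + w ^ 2 - 1) = 0" "w \<noteq> 0"
  shows "w ^ (n - m) = 1"
proof -
  have "w ^ 3 - w - 1 \<noteq> 0"
  proof
    assume *: "w ^ 3 - w - 1 = 0"
    then have **: "w ^ 3 + w ^ 2 - 1 = 0" using root by simp
    have "w * (w + 1) = (w ^ 3 + w ^ 2 - 1) - (w ^ 3 - w - 1)"
      by (simp add: power2_eq_square algebra_simps)
    then have "w = 0 \<or> w = -1" using * ** by (auto simp: add_eq_0_iff2)
    then show False using * by auto
  qed
  moreover have "(w ^ (n - 2) - w ^ (m - 2)) * (w ^ 3 - w - 1) = 0"
  proof -
    have "(w ^ (n - 2) - w ^ (m - 2)) * (w ^ 3 - w - 1)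
      = (w ^ (n - 2) * (w ^ 3 - w - 1) + (w ^ 3 + w ^ 2 - 1))
        - (w ^ (m - 2) * (w ^ 3 - w - 1) + (w ^ 3 + w ^ 2 - 1))"
      by (simp add: algebra_simps)
    then show ?thesis unfolding root assms(3) by simp
  qed
  ultimately have "w ^ (n - 2) = w ^ (m - 2)" by simp
  moreover have "n - 2 = (m - 2) + (n - m)" using assms by simp
  ultimately show ?thesis using assms(4) by (simp add: power_add)
qed

text \<open>The cyclotomic polynomials of orders 3, 5, 12 and 30 divide the Coxeter polynomials of
  the finite types with index 3, 4, 6 and 8. In each case the comparison with that index makes the
  order of \<open>w\<close> divide \<open>n\<close> minus the index, against the residue of
  \<open>n\<close>.\<close>

lemma not_phi3: "w ^ 2 + w + 1 \<noteq> 0"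
proof
  assume *: "w ^ 2 + w + 1 = 0"
  have w3: "w ^ 3 - 1 = (w - 1) * (w ^ 2 + w + 1)"
    by (simp add: power2_eq_square power3_eq_cube algebra_simps)
  have "w ^ (3 - 2) * (w ^ 3 - w - 1) + (w ^ 3 + w ^ 2 - 1) = (w ^ 2 + w + 1) * (w ^ 2 - 1)"
    by (simp add: power2_eq_square power3_eq_cube algebra_simps)
  then have "w ^ (n - 3) = 1" using * n(1) by (intro coxeter_root_power) auto
  moreover have "w ^ 3 = 1" using w3 * by simp
  ultimately have "w ^ gcd (n - 3) 3 = 1" by (rule power_gcd_eq_1)
  moreover have "\<not> 3 dvd n - 3" using n(1,3) by presburger
  then have "coprime (n - 3) 3" using prime_imp_coprime[of 3 "n - 3"] by (simp add: algebraic_semidom_class.coprime_commute)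
  ultimately have "w = 1" by simp
  then show False using * by simp
qed

lemma not_phi5: "w ^ 4 + w ^ 3 + w ^ 2 + w + 1 \<noteq> 0"
proof
  assume *: "w ^ 4 + w ^ 3 + w ^ 2 + w + 1 = 0"
  have w5: "w ^ 5 - 1 = (w - 1) * (w ^ 4 + w ^ 3 + w ^ 2 + w + 1)"
    by (simp add: eval_nat_numeral algebra_simps)
  have "w ^ (4 - 2) * (w ^ 3 - w - 1) + (w ^ 3 + w ^ 2 - 1) = w ^ 5 - 1"
    by (simp add: eval_nat_numeral algebra_simps)
  then have "w ^ (n - 4) = 1" using * w5 n(1) by (intro coxeter_root_power) auto
  moreover have "w ^ 5 = 1" using w5 * by simp
  ultimately have "w ^ gcd (n - 4) 5 = 1" by (rule power_gcd_eq_1)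
  moreover have "\<not> 5 dvd n - 4"
    using n(1,4) by presburger
  then have "coprime (n - 4) 5" using prime_imp_coprime[of 5 "n - 4"] by (simp add: algebraic_semidom_class.coprime_commute)
  ultimately have "w = 1" by simp
  then show False using * by simp
qed

lemma not_phi12: "w ^ 4 - w ^ 2 + 1 \<noteq> 0"
proof
  assume *: "w ^ 4 - w ^ 2 + 1 = 0"
  have w12: "w ^ 12 - 1 = (w ^ 4 - w ^ 2 + 1) * ((w ^ 2 + 1) * (w ^ 6 - 1))"
    by (simp add: eval_nat_numeral algebra_simps)
  have "w ^ (6 - 2) * (w ^ 3 - w - 1) + (w ^ 3 + w ^ 2 - 1) = (w ^ 4 - w ^ 2 + 1) * (w ^ 3 - 1)"
    by (simp add: eval_nat_numeral algebra_simps)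
  then have "w ^ (n - 6) = 1" using * n(1) by (intro coxeter_root_power) auto
  moreover have "w ^ 12 = 1" using w12 * by simp
  ultimately have g: "w ^ gcd (n - 6) 12 = 1" by (rule power_gcd_eq_1)
  define g where "g = gcd (n - 6) 12"
  have "g dvd 12" "g dvd n - 6" by (simp_all add: g_def)
  \<comment> \<open>Losing the factor 3 already suffices: an exponent dividing 4 gives
    \<open>w ^ 4 = 1\<close>, which is incompatible with the order 12.\<close>
  moreover have "\<not> 3 dvd n - 6" using n(1,3) by presburger
  ultimately have "\<not> 3 dvd g" using dvd_trans by blast
  then have "coprime g 3" using prime_imp_coprime[of 3 g] by (simp add: algebraic_semidom_class.coprime_commute)
  then have "g dvd 4" using \<open>g dvd 12\<close> coprime_dvd_mult_right_iff[of g 3 4] by simp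
  then have "w ^ 4 = 1" using g unfolding g_def[symmetric] by (metis dvdE power_mult power_one)
  then have "w ^ 2 = 2" using * by simp
  moreover have "w ^ 4 = (w ^ 2) ^ 2" by (simp flip: power_mult)
  ultimately have "w ^ 4 = 4" by simp
  then show False using \<open>w ^ 4 = 1\<close> by simp
qed

lemma not_phi30: "w ^ 8 + w ^ 7 - w ^ 5 - w ^ 4 - w ^ 3 + w + 1 \<noteq> 0"
proof
  assume *: "w ^ 8 + w ^ 7 - w ^ 5 - w ^ 4 - w ^ 3 + w + 1 = 0"
  have "w ^ 15 + 1 = (w ^ 8 + w ^ 7 - w ^ 5 - w ^ 4 - w ^ 3 + w + 1)
      * ((w + 1) * (w ^ 2 - w + 1) * (w ^ 4 - w ^ 3 + w ^ 2 - w + 1))"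
    by (simp add: eval_nat_numeral algebra_simps)
  then have w15: "w ^ 15 = -1" using * by (simp add: add_eq_0_iff2)
  have "w ^ 30 = (w ^ 15) ^ 2" by (simp flip: power_mult)
  then have w30: "w ^ 30 = 1" using w15 by simp
  have "w ^ (8 - 2) * (w ^ 3 - w - 1) + (w ^ 3 + w ^ 2 - 1)
      = (w ^ 8 + w ^ 7 - w ^ 5 - w ^ 4 - w ^ 3 + w + 1) * (w - 1)"
    by (simp add: eval_nat_numeral algebra_simps)
  then have "w ^ (n - 8) = 1" using * n(1) by (intro coxeter_root_power) auto
  from power_gcd_eq_1[OF this w30] have g: "w ^ gcd (n - 8) 30 = 1" .
  define g where "g = gcd (n - 8) 30"
  have "g dvd 30" "g dvd n - 8" by (simp_all add: g_def)
  moreover have "\<not> 30 dvd n - 8" using n(1,5) by presburger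
  ultimately have "\<not> 30 dvd g" using dvd_trans by blast
  \<comment> \<open>A proper divisor of 30 misses one of the primes 2, 3, 5, hence divides 15, 10 or
    6.\<close>
  moreover have "30 dvd g" if "2 dvd g" "3 dvd g" "5 dvd g" using that by presburger
  ultimately consider "\<not> 2 dvd g" | "\<not> 3 dvd g" | "\<not> 5 dvd g" by blast
  then have "g dvd 6 \<or> g dvd 10 \<or> g dvd 15"
  proof cases
    case 1
    then have "coprime g 2" using prime_imp_coprime[of 2 g] by (simp add: algebraic_semidom_class.coprime_commute)
    then show ?thesis using \<open>g dvd 30\<close> coprime_dvd_mult_right_iff[of g 2 15] by simp
  next
    case 2
    then have "coprime g 3" using prime_imp_coprime[of 3 g] by (simp add: algebraic_semidom_class.coprime_commute)
    then show ?thesis using \<open>g dvd 30\<close> coprime_dvd_mult_right_iff[of g 3 10] by simp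
  next
    case 3
    then have "coprime g 5" using prime_imp_coprime[of 5 g] by (simp add: algebraic_semidom_class.coprime_commute)
    then show ?thesis using \<open>g dvd 30\<close> coprime_dvd_mult_right_iff[of g 5 6] by simp
  qed
  \<comment> \<open>As \<open>w ^ 15 = -1\<close>, the first two cases give
    \<open>w ^ 3 = -1\<close> and \<open>w ^ 5 = -1\<close>; the degree 8 relation is then reduced
    by these and compared with each factor of \<open>w ^ 3 + 1\<close> or
    \<open>w ^ 5 + 1\<close>.\<close>
  then consider "w ^ 6 = 1" | "w ^ 10 = 1" | "w ^ 15 = 1"
    using g unfolding g_def[symmetric] by (metis dvdE power_mult power_one)
  then show False
  proof cases
    case 1
    have "w ^ 15 = (w ^ 6) ^ 2 * w ^ 3" by (simp flip: power_mult power_add)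
    then have w3: "w ^ 3 = -1" using 1 w15 by simp
    have "w ^ 8 + w ^ 7 - w ^ 5 - w ^ 4 - w ^ 3 + w + 1
       = w ^ 3 * w ^ 3 * w ^ 2 + w ^ 3 * w ^ 3 * w - w ^ 3 * w ^ 2 - w ^ 3 * w - w ^ 3 + w + 1"
      by (simp add: eval_nat_numeral algebra_simps)
    with * w3 have e: "2 * w ^ 2 + 3 * w + 2 = 0" by (simp add: algebra_simps)
    have "(w + 1) * (w ^ 2 - w + 1) = 0"
      using w3 by (simp add: eval_nat_numeral algebra_simps)
    then consider "w + 1 = 0" | "w ^ 2 - w + 1 = 0" unfolding mult_eq_0_iff by blast
    then show False
    proof cases
      case 1
      then have "w = -1" by (simp add: add_eq_0_iff2)
      with e show False by simp
    next
      case 2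
      have "5 * w = (2 * w ^ 2 + 3 * w + 2) - 2 * (w ^ 2 - w + 1)" by (simp add: algebra_simps)
      then have "w = 0" unfolding e 2 by simp
      then show False using * by simp
    qed
  next
    case 2
    have "w ^ 15 = w ^ 10 * w ^ 5" by (simp flip: power_add)
    then have w5: "w ^ 5 = -1" using 2 w15 by simp
    have "w ^ 8 + w ^ 7 - w ^ 5 - w ^ 4 - w ^ 3 + w + 1
       = w ^ 5 * w ^ 3 + w ^ 5 * w ^ 2 - w ^ 5 - w ^ 4 - w ^ 3 + w + 1"
      by (simp add: eval_nat_numeral algebra_simps)
    with * w5 have e: "- (w ^ 4) - 2 * w ^ 3 - w ^ 2 + w + 2 = 0" by (simp add: algebra_simps)
    have "(w + 1) * (w ^ 4 - w ^ 3 + w ^ 2 - w + 1) = 0"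
      using w5 by (simp add: eval_nat_numeral algebra_simps)
    then consider "w + 1 = 0" | "w ^ 4 - w ^ 3 + w ^ 2 - w + 1 = 0" unfolding mult_eq_0_iff by blast
    then show False
    proof cases
      case 1
      then have "w = -1" by (simp add: add_eq_0_iff2)
      with e show False by simp
    next
      case 2
      have "3 * (1 - w ^ 3) = (- (w ^ 4) - 2 * w ^ 3 - w ^ 2 + w + 2) + (w ^ 4 - w ^ 3 + w ^ 2 - w + 1)"
        by (simp add: algebra_simps)
      then have "w ^ 3 = 1" unfolding e 2 by simp
      moreover have "w ^ 15 = (w ^ 3) ^ 5" by (simp flip: power_mult)
      ultimately show False using w15 by simp
    qed
  next
    case 3
    then show False using w15 by simp
  qed
qed

text \<open>The conjugate is chosen by the 2-part of the order of \<open>w\<close>. Since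
  \<open>n - 2\<close> is even, signs disappear from its power, so the conjugate equation contains
  only \<open>u\<close> or \<open>u ^ 2\<close>.\<close>

lemma coxeter_root_not_root_of_unity:
  assumes "N > 0" "w ^ N = 1" "w \<noteq> 1"
  shows False
proof -
  \<comment> \<open>The exact order is needed: minimality gives \<open>w ^ l = -1\<close> when
    \<open>k = 2 * l\<close>.\<close>
  define k where "k = (LEAST k. k > 0 \<and> w ^ k = 1)"
  have k: "k > 0" "w ^ k = 1"
    using LeastI[of "\<lambda>k. k > 0 \<and> w ^ k = 1" N] assms unfolding k_def by auto
  have kmin: "\<not> (m > 0 \<and> w ^ m = 1)" if "m < k" for m
    using that not_less_Least unfolding k_def by blast
  have "w \<noteq> 0" using k by (metis power_0_left zero_neq_one less_irrefl)
  define u where "u = w ^ (n - 2)"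
  have u: "u * (w ^ 3 - w - 1) + (w ^ 3 + w ^ 2 - 1) = 0" using root by (simp add: u_def)
  have conj: "(w ^ j) ^ (n - 2) * ((w ^ j) ^ 3 - w ^ j - 1) + ((w ^ j) ^ 3 + (w ^ j) ^ 2 - 1) = 0"
    if "coprime j k" for j
    using conjugate_coprime_power[OF that k, of "coxeter_poly n"] root unfolding cpoly_coxeter by simp
  have half: "w ^ l = -1" if "k = 2 * l" for l
  proof -
    have "(w ^ l) ^ 2 = 1" using k(2) that by (simp flip: power_mult add: mult.commute)
    moreover have "w ^ l \<noteq> 1" using kmin[of l] k(1) that by auto
    ultimately show ?thesis by (simp add: power2_eq_1_iff)
  qed
  have ev: "even (n - 2)" using n(2) by simp
  have "odd k \<or> 4 dvd k \<or> (\<exists>l. k = 2 * l \<and> odd l)" by presburger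
  then consider "odd k" | "4 dvd k" | l where "k = 2 * l" "odd l" by blast
  then show False
  proof cases
    case 1
    then have c: "u ^ 2 * ((w ^ 2) ^ 3 - w ^ 2 - 1) + ((w ^ 2) ^ 3 + (w ^ 2) ^ 2 - 1) = 0"
      using conj[of 2] by (simp add: u_def algebraic_semidom_class.coprime_commute mult.commute flip: power_mult)
    define P R P2 R2 where "P = w ^ 3 - w - 1" and "R = w ^ 3 + w ^ 2 - 1"
      and "P2 = (w ^ 2) ^ 3 - w ^ 2 - 1" and "R2 = (w ^ 2) ^ 3 + (w ^ 2) ^ 2 - 1"
    have uP: "u * P = - R" using u unfolding P_def R_def by (simp add: add_eq_0_iff2)
    \<comment> \<open>Multiplying the conjugate equation by \<open>P ^ 2\<close> and using
      \<open>u * P = - R\<close> eliminates \<open>u\<close>, and with it \<open>n\<close>.\<close>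
    have "R ^ 2 * P2 + R2 * P ^ 2 = (u * P) ^ 2 * P2 + R2 * P ^ 2" unfolding uP by simp
    also have "\<dots> = P ^ 2 * (u ^ 2 * P2 + R2)" by (simp add: power2_eq_square algebra_simps)
    also have "\<dots> = 0" using c unfolding P2_def R2_def by simp
    finally have "R ^ 2 * P2 + R2 * P ^ 2 = 0" .
    moreover have "R ^ 2 * P2 + R2 * P ^ 2 =
      2 * (w - 1) ^ 3 * (w + 1) * (w ^ 2 + w + 1) ^ 2 * (w ^ 4 + w ^ 3 + w ^ 2 + w + 1)"
      unfolding P_def R_def P2_def R2_def by (simp add: eval_nat_numeral algebra_simps)
    ultimately have "w = -1"
      using not_phi3 not_phi5 assms(3) by (auto simp: add_eq_0_iff2)
    then show False using root ev by simp
  next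
    case 2
    then obtain m where m: "k = 4 * m" by blast
    have "coprime (2 * m + 1) k" using coprime_half_plus_1[OF 2] m by simp
    moreover have "w ^ (2 * m + 1) = - w" using half[of "2 * m"] m by simp
    ultimately have c: "u * ((- w) ^ 3 + w - 1) + ((- w) ^ 3 + w ^ 2 - 1) = 0"
      using conj[of "2 * m + 1"] ev by (simp add: u_def)
    \<comment> \<open>The equations for \<open>w\<close> and \<open>- w\<close> share the same
      \<open>u\<close>: their sum determines \<open>u\<close>, and their difference then gives the
      cyclotomic relation of order 12.\<close>
    have u1: "u = w ^ 2 - 1"
    proof -
      have *: "2 * (u - (w ^ 2 - 1)) = - (u * (w ^ 3 - w - 1) + (w ^ 3 + w ^ 2 - 1))
         - (u * ((- w) ^ 3 + w - 1) + ((- w) ^ 3 + w ^ 2 - 1))"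
        by (simp add: eval_nat_numeral algebra_simps)
      have "2 * (u - (w ^ 2 - 1)) = 0" unfolding * u c by simp
      then show ?thesis unfolding mult_eq_0_iff by simp
    qed
    have *: "2 * w * (u * (w ^ 2 - 1) + w ^ 2) = (u * (w ^ 3 - w - 1) + (w ^ 3 + w ^ 2 - 1))
         - (u * ((- w) ^ 3 + w - 1) + ((- w) ^ 3 + w ^ 2 - 1))"
      by (simp add: eval_nat_numeral algebra_simps)
    have "2 * w * (u * (w ^ 2 - 1) + w ^ 2) = 0" unfolding * u c by simp
    then have "u * (w ^ 2 - 1) + w ^ 2 = 0" using \<open>w \<noteq> 0\<close> by simp
    moreover have "(w ^ 2 - 1) * (w ^ 2 - 1) + w ^ 2 = w ^ 4 - w ^ 2 + 1"
      by (simp add: eval_nat_numeral algebra_simps)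
    ultimately show False using not_phi12 unfolding u1 by simp
  next
    case 3
    have "w ^ (l + 2) = - (w ^ 2)" using half[OF 3(1)] by (simp add: power2_eq_square)
    then have c: "u ^ 2 * ((- (w ^ 2)) ^ 3 + w ^ 2 - 1) + ((- (w ^ 2)) ^ 3 + (- (w ^ 2)) ^ 2 - 1) = 0"
      using conj[of "l + 2"] coprime_odd_plus_2[OF 3(2)] ev
      by (simp add: 3(1) u_def mult.commute flip: power_mult)
    define P R P2 R2 where "P = w ^ 3 - w - 1" and "R = w ^ 3 + w ^ 2 - 1"
      and "P2 = (- (w ^ 2)) ^ 3 + w ^ 2 - 1" and "R2 = (- (w ^ 2)) ^ 3 + (- (w ^ 2)) ^ 2 - 1"
    have uP: "u * P = - R" using u unfolding P_def R_def by (simp add: add_eq_0_iff2)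
    \<comment> \<open>The same elimination, now with the conjugate \<open>- (w ^ 2)\<close>; only
      orders 12 and 30 survive.\<close>
    have "R ^ 2 * P2 + R2 * P ^ 2 = (u * P) ^ 2 * P2 + R2 * P ^ 2" unfolding uP by simp
    also have "\<dots> = P ^ 2 * (u ^ 2 * P2 + R2)" by (simp add: power2_eq_square algebra_simps)
    also have "\<dots> = 0" using c unfolding P2_def R2_def by simp
    finally have "R ^ 2 * P2 + R2 * P ^ 2 = 0" .
    moreover have "R ^ 2 * P2 + R2 * P ^ 2 =
      - 2 * (w ^ 4 - w ^ 2 + 1) * (w ^ 8 + w ^ 7 - w ^ 5 - w ^ 4 - w ^ 3 + w + 1)"
      unfolding P_def R_def P2_def R2_def by (simp add: eval_nat_numeral algebra_simps)
    ultimately have "- 2 * (w ^ 4 - w ^ 2 + 1) * (w ^ 8 + w ^ 7 - w ^ 5 - w ^ 4 - w ^ 3 + w + 1) = 0"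
      by simp
    then show False
      using not_phi12 not_phi30 unfolding mult_eq_0_iff by simp
  qed
qed

end

section \<open>Characteristic polynomials of paths and of the trees\<close>

text \<open>The characteristic polynomial of the path on \<open>k\<close> vertices, which is the
  Chebyshev polynomial of the second kind at \<open>x / 2\<close>.\<close>

fun path_poly :: "nat \<Rightarrow> int poly" where
  "path_poly 0 = [:1:]"
| "path_poly (Suc 0) = [:0, 1:]"
| "path_poly (Suc (Suc k)) = [:0, 1:] * path_poly (Suc k) - path_poly k"

text \<open>\<open>tree_poly k\<close> will be the characteristic polynomial of \<open>G\<^bsub>k + 3, 3\<^esub>\<close>; at \<open>k = 0\<close> vertex 3 is
  isolated.\<close>

fun tree_poly :: "nat \<Rightarrow> int poly" where
  "tree_poly 0 = [:0, 1:] * path_poly 2"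
| "tree_poly (Suc 0) = path_poly 4"
| "tree_poly (Suc (Suc k)) = [:0, 1:] * tree_poly (Suc k) - tree_poly k"

lemma path_poly_2: "path_poly 2 = [:-1, 0, 1:]"
  by (simp add: numeral_2_eq_2 del: pCons_one)

lemma path_poly_4: "path_poly 4 = [:1, 0, -3, 0, 1:]"
  by (simp add: eval_nat_numeral del: pCons_one)

text \<open>Expansion at the edge between vertices 3 and 4: without it a path on 4 vertices splits
  off; without both ends an isolated vertex and a path on 2 vertices do. Both sides obey the same
  recurrence.\<close>

lemma tree_poly_eq: "tree_poly (Suc (Suc k)) = path_poly 4 * path_poly (Suc k) - [:0, 1:] * path_poly 2 * path_poly k"
proof (induction k rule: induct_nat_012)
  case (ge2 k)
  have "[:0, 1:] * (a * q - b * r) - (a * r - b * s) = a * ([:0, 1:] * q - r) - b * ([:0, 1:] * r - s)"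
    for a b q r s :: "int poly"
    by (simp only: algebra_simps)
  then show ?case
    unfolding tree_poly.simps(3)[of "Suc (Suc k)"] ge2 path_poly.simps(3)[of "Suc k"]
    by (metis path_poly.simps(3))
qed (simp_all add: algebra_simps)

lemma tree_poly_2: "tree_poly 2 = [:0, 2, 0, -4, 0, 1:]"
  by (simp add: eval_nat_numeral del: pCons_one)

lemma tree_poly_3: "tree_poly 3 = [:-1, 0, 5, 0, -5, 0, 1:]"
  by (simp add: eval_nat_numeral del: pCons_one)

text \<open>The power of \<open>z\<close> clears denominators and \<open>z ^ 2 - 1\<close> supplies
  the extra factor \<open>w - 1\<close> of \<open>coxeter_poly\<close>. Both sides then satisfy the
  recurrence with characteristic roots 1 and \<open>z ^ 2\<close>.\<close>

lemma tree_poly_joukowski: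
  assumes "z \<noteq> 0"
  shows "cpoly (tree_poly k) (z + 1 / z) * ((z ^ 2 - 1) * z ^ (k + 3)) = cpoly (coxeter_poly (k + 3)) (z ^ 2)"
proof -
  define y where "y = 1 / z"
  have zy: "z * y = 1" using assms by (simp add: y_def)
  define L where "L k = (z ^ 2) ^ (k + 1) * ((z ^ 2) ^ 3 - z ^ 2 - 1) + ((z ^ 2) ^ 3 + (z ^ 2) ^ 2 - 1)" for k
  define t where "t k = cpoly (tree_poly k) (z + y)" for k
  have t: "t (Suc (Suc k)) = (z + y) * t (Suc k) - t k" for k
    by (simp add: t_def cpoly_hom cpoly_pCons algebra_simps)
  have L: "L (Suc (Suc k)) = (z ^ 2 + 1) * L (Suc k) - z ^ 2 * L k" for k
    by (simp add: L_def algebra_simps)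
  have t0: "t 0 = (z + y) * ((z + y) ^ 2 - 1)" and t1: "t 1 = (z + y) ^ 4 - 3 * (z + y) ^ 2 + 1"
    by (simp_all add: t_def cpoly_hom cpoly_pCons path_poly_2 path_poly_4)
      (simp_all add: eval_nat_numeral algebra_simps)
  have "t k * ((z ^ 2 - 1) * z ^ (k + 3)) = L k"
  proof (induction k rule: induct_nat_012)
    case 0
    have "t 0 * z ^ 3 = (z * z + z * y) * ((z * z + z * y) ^ 2 - z ^ 2)"
      unfolding t0 by (simp add: eval_nat_numeral algebra_simps)
    then have "t 0 * z ^ 3 = (z * z + 1) * ((z * z + 1) ^ 2 - z ^ 2)" unfolding zy .
    then have "(t 0 * z ^ 3) * (z ^ 2 - 1) = L 0"
      by (simp add: L_def eval_nat_numeral algebra_simps)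
    then show ?case by (simp add: mult_ac)
  next
    case 1
    have "t 1 * z ^ 4 = (z * z + z * y) ^ 4 - 3 * z ^ 2 * (z * z + z * y) ^ 2 + z ^ 4"
      unfolding t1 by (simp add: eval_nat_numeral algebra_simps)
    then have "t 1 * z ^ 4 = (z * z + 1) ^ 4 - 3 * z ^ 2 * (z * z + 1) ^ 2 + z ^ 4" unfolding zy .
    then have "(t 1 * z ^ 4) * (z ^ 2 - 1) = L 1"
      by (simp add: L_def eval_nat_numeral algebra_simps)
    then show ?case by (simp add: mult_ac)
  next
    case (ge2 k)
    have "t (Suc (Suc k)) * ((z ^ 2 - 1) * z ^ (Suc (Suc k) + 3))
       = (z * z + z * y) * (t (Suc k) * ((z ^ 2 - 1) * z ^ (Suc k + 3)))
         - z ^ 2 * (t k * ((z ^ 2 - 1) * z ^ (k + 3)))"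
      unfolding t by (simp add: power_add eval_nat_numeral algebra_simps)
    then show ?case unfolding ge2 zy L by (simp add: power2_eq_square)
  qed
  then show ?thesis unfolding t_def y_def cpoly_coxeter L_def by simp
qed

text \<open>At 2 the recurrence says that second differences vanish. In terms of
  \<open>n = k + 3\<close> the value is \<open>9 - n\<close>; its zero is the affine diagram of type
  E8.\<close>

lemma tree_poly_at_2: "cpoly (tree_poly k) 2 = 6 - of_nat k"
proof (induction k rule: induct_nat_012)
  case (ge2 k)
  then show ?case by (simp add: cpoly_hom cpoly_pCons)
qed (simp_all add: cpoly_hom cpoly_pCons path_poly_2 path_poly_4)

lemma tree_poly_minus: "cpoly (tree_poly k) (- x) = (- 1) ^ (k + 3) * cpoly (tree_poly k) x"
proof (induction k rule: induct_nat_012)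
  case (ge2 k)
  then show ?case by (simp add: cpoly_hom cpoly_pCons power_add algebra_simps)
qed (simp_all add: cpoly_hom cpoly_pCons path_poly_2 path_poly_4)

text \<open>For \<open>n = k + 5\<close> these count, up to sign, the edges and the pairs of
  disjoint edges; the last identity is doubled to avoid a division.\<close>

lemma tree_poly_leading_coeffs:
  "degree (tree_poly (k + 2)) = k + 5 \<and> coeff (tree_poly (k + 2)) (k + 5) = 1
   \<and> coeff (tree_poly (k + 2)) (k + 3) = - int (k + 4)
   \<and> 2 * coeff (tree_poly (k + 2)) (k + 1) = int ((k + 4) * (k + 1))"
proof -
  have "degree (tree_poly (k + 2)) \<le> k + 5 \<and> coeff (tree_poly (k + 2)) (k + 5) = 1
   \<and> coeff (tree_poly (k + 2)) (k + 3) = - int (k + 4)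
   \<and> 2 * coeff (tree_poly (k + 2)) (k + 1) = int ((k + 4) * (k + 1))"
  proof (induction k rule: induct_nat_012)
    case 0
    show ?case using tree_poly_2 by (simp add: numeral_eq_Suc)
  next
    case 1
    show ?case using tree_poly_3 by (simp add: numeral_eq_Suc)
  next
    case (ge2 k)
    define A B where "A = tree_poly (Suc k + 2)" and "B = tree_poly (k + 2)"
    have T: "tree_poly (Suc (Suc k) + 2) = pCons 0 A - B" by (simp add: A_def B_def)
    have "degree (pCons 0 A - B) \<le> Suc (Suc k) + 5"
      using ge2 unfolding A_def[symmetric] B_def[symmetric]
      by (intro degree_diff_le degree_pCons_le[THEN le_trans]) auto
    moreover have "coeff B (k + 7) = 0"
      using ge2 unfolding B_def[symmetric] by (intro coeff_eq_0) simp
    ultimately show ?case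
      using ge2 unfolding T unfolding A_def[symmetric] B_def[symmetric]
      by (simp add: numeral_eq_Suc algebra_simps)
  qed
  then show ?thesis using le_degree[of "tree_poly (k + 2)" "k + 5"] by auto
qed

text \<open>Deleting vertex 3 interlaces the eigenvalues with those of paths: the quotient of \<open>tree_poly\<close>
  by the product of the path polynomials maps the upper half-plane to itself.\<close>

lemma Im_inverse_neg: "Im a > 0 \<Longrightarrow> Im (1 / a) < 0"
proof -
  assume *: "Im a > 0"
  have "Im (1 / a) = - (Im a / ((Re a)\<^sup>2 + (Im a)\<^sup>2))" by (simp add: Im_divide)
  moreover have "Im a / ((Re a)\<^sup>2 + (Im a)\<^sup>2) > 0" using * by (intro divide_pos_pos add_nonneg_pos) auto
  ultimately show ?thesis by simp
qed

text \<open>Continued fraction: \<open>x\<close> minus a ratio in the lower half-plane lies in the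
  upper one, and inversion returns it to the lower one.\<close>

lemma path_poly_upper_half_plane:
  assumes "Im x > 0"
  shows "cpoly (path_poly (Suc k)) x \<noteq> 0 \<and> Im (cpoly (path_poly k) x / cpoly (path_poly (Suc k)) x) < 0"
proof (induction k)
  case 0
  have "x \<noteq> 0" using assms by auto
  then show ?case using Im_inverse_neg[OF assms] by (simp add: cpoly_pCons)
next
  case (Suc k)
  let ?P = "\<lambda>k. cpoly (path_poly k) x"
  have *: "?P (Suc (Suc k)) / ?P (Suc k) = x - ?P k / ?P (Suc k)"
    using Suc by (simp add: cpoly_hom cpoly_pCons field_simps)
  have "Im (?P (Suc (Suc k)) / ?P (Suc k)) > 0"
    unfolding * using Suc assms by simp
  moreover from this have "?P (Suc (Suc k)) \<noteq> 0" by auto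
  ultimately show ?case using Im_inverse_neg[of "?P (Suc (Suc k)) / ?P (Suc k)"] by simp
qed

text \<open>This is \<open>path_poly 4\<close> over \<open>x * path_poly 2\<close>. All poles have
  negative residues, which controls both the imaginary part over the complex numbers and
  monotonicity over the reals.\<close>

lemma partial_fractions:
  fixes x :: "'a::field_char_0"
  assumes "x \<noteq> 0" "x \<noteq> 1" "x \<noteq> - 1"
  shows "(x ^ 4 - 3 * x ^ 2 + 1) / (x * (x ^ 2 - 1)) = x - 1 / x - 1 / 2 * (1 / (x - 1)) - 1 / 2 * (1 / (x + 1))"
proof -
  define a b c h where "a = 1 / x" and "b = 1 / (x - 1)" and "c = 1 / (x + 1)" and "h = (1 / 2 :: 'a)"
  have nz: "x - 1 \<noteq> 0" "x + 1 \<noteq> 0"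
    using assms by (auto simp: eq_neg_iff_add_eq_0)
  then have e: "x * a = 1" "(x - 1) * b = 1" "(x + 1) * c = 1"
    using assms(1) by (auto simp: a_def b_def c_def)
  have D: "x ^ 2 - 1 = (x - 1) * (x + 1)" by (simp add: power2_eq_square algebra_simps)
  have "h * 2 = 1" by (simp add: h_def)
  have "(x - a - h * b - h * c) * (x * ((x - 1) * (x + 1)))
    = x * x * (x - 1) * (x + 1) - (x * a) * ((x - 1) * (x + 1))
      - h * x * (x + 1) * ((x - 1) * b) - h * x * (x - 1) * ((x + 1) * c)"
    by (simp add: algebra_simps)
  also have "\<dots> = x * x * (x - 1) * (x + 1) - (x - 1) * (x + 1) - (h * 2) * x * x"
    unfolding e by (simp add: algebra_simps)
  also have "\<dots> = x ^ 4 - 3 * x ^ 2 + 1"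
    unfolding \<open>h * 2 = 1\<close> by (simp add: eval_nat_numeral algebra_simps)
  finally have "x ^ 4 - 3 * x ^ 2 + 1 = (x - a - h * b - h * c) * (x * ((x - 1) * (x + 1)))" ..
  then show ?thesis using assms(1) nz
    unfolding D a_def[symmetric] b_def[symmetric] c_def[symmetric] h_def[symmetric] by simp
qed

lemma tree_poly_real_rooted:
  assumes "cpoly (tree_poly (Suc (Suc k))) x = 0"
  shows "Im x = 0"
proof -
  have "cpoly (tree_poly (Suc (Suc k))) x \<noteq> 0" if x: "Im x > 0" for x
  proof -
    let ?P = "\<lambda>k. cpoly (path_poly k) x"
    have nz: "x \<noteq> 0" "x \<noteq> 1" "x \<noteq> -1" using x by auto
    have nz': "x ^ 2 - 1 \<noteq> 0"
      using nz by (simp add: power2_eq_1_iff)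
    have P: "?P (Suc k) \<noteq> 0" "Im (?P k / ?P (Suc k)) < 0"
      using path_poly_upper_half_plane[OF x] by auto
    have "cpoly (tree_poly (Suc (Suc k))) x = (x ^ 4 - 3 * x ^ 2 + 1) * ?P (Suc k) - x * (x ^ 2 - 1) * ?P k"
      unfolding tree_poly_eq cpoly_hom path_poly_2 path_poly_4
      by (simp add: cpoly_pCons eval_nat_numeral algebra_simps)
    also have "\<dots> = x * (x ^ 2 - 1) * ?P (Suc k) *
        ((x ^ 4 - 3 * x ^ 2 + 1) / (x * (x ^ 2 - 1)) - ?P k / ?P (Suc k))"
      using nz nz' P(1) by (simp add: right_diff_distrib)
    finally have *: "cpoly (tree_poly (Suc (Suc k))) x = \<dots>" .
    have "Im (1 / x) < 0" "Im (1 / (x - 1)) < 0" "Im (1 / (x + 1)) < 0"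
      using x by (auto intro!: Im_inverse_neg)
    moreover have "Im (1 / 2 * a) < 0" if "Im a < 0" for a using that by simp
    ultimately have "Im (1 / x) < 0" "Im (1 / 2 * (1 / (x - 1))) < 0" "Im (1 / 2 * (1 / (x + 1))) < 0"
      by blast+
    then have "Im ((x ^ 4 - 3 * x ^ 2 + 1) / (x * (x ^ 2 - 1)) - ?P k / ?P (Suc k)) > 0"
      unfolding partial_fractions[OF nz] minus_complex.sel using P(2) x by linarith
    then show ?thesis unfolding * using nz nz' P(1) by auto
  qed
  \<comment> \<open>Negation exchanges the half-planes and preserves zeros, so the lower half-plane
    is excluded too.\<close>
  from this[of x] this[of "- x"] assms have "\<not> Im x > 0" "\<not> Im (- x) > 0"
    unfolding tree_poly_minus by auto
  then show ?thesis by simp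
qed

section \<open>Eigenvalues greater than 2\<close>

abbreviation rpoly :: "int poly \<Rightarrow> real \<Rightarrow> real" where
  "rpoly p \<equiv> poly (map_poly of_int p)"

lemma cpoly_of_real: "cpoly p (of_real x) = of_real (rpoly p x)"
  by (induction p) (simp_all add: cpoly_pCons of_int_hom.map_poly_pCons_hom)

lemma rpoly_hom:
  "rpoly (p - q) x = rpoly p x - rpoly q x"
  "rpoly (- p) x = - rpoly p x"
  "rpoly (p * q) x = rpoly p x * rpoly q x"
  "rpoly (pCons a p) x = of_int a + x * rpoly p x"
  by (simp_all add: of_int_poly_hom.hom_minus of_int_poly_hom.hom_uminus of_int_poly_hom.hom_mult
      of_int_hom.map_poly_pCons_hom)

lemma path_poly_increasing:
  assumes "x > 2"
  shows "1 \<le> rpoly (path_poly k) x \<and> rpoly (path_poly k) x < rpoly (path_poly (Suc k)) x"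
proof (induction k)
  case 0
  then show ?case using assms by (simp add: rpoly_hom)
next
  case (Suc k)
  have "2 * rpoly (path_poly (Suc k)) x < x * rpoly (path_poly (Suc k)) x"
    using Suc assms by simp
  moreover have "rpoly (path_poly (Suc (Suc k))) x = x * rpoly (path_poly (Suc k)) x - rpoly (path_poly k) x"
    by (simp add: rpoly_hom)
  ultimately show ?case using Suc by linarith
qed

text \<open>Each ratio is the reciprocal of \<open>z\<close> minus the preceding ratio. That
  denominator increases with \<open>z\<close> and stays positive, because the preceding ratio is
  below 1.\<close>

lemma path_poly_ratio_antimono:
  assumes "2 < x" "x \<le> y"
  shows "rpoly (path_poly k) y / rpoly (path_poly (Suc k)) y \<le> rpoly (path_poly k) x / rpoly (path_poly (Suc k)) x"
proof (induction k)
  case 0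
  then show ?case using assms by (simp add: rpoly_hom frac_le)
next
  case (Suc k)
  have rec: "rpoly (path_poly (Suc k)) z / rpoly (path_poly (Suc (Suc k))) z
      = 1 / (z - rpoly (path_poly k) z / rpoly (path_poly (Suc k)) z)
    \<and> z - rpoly (path_poly k) z / rpoly (path_poly (Suc k)) z > 0" if "z > 2" for z
  proof -
    let ?P = "\<lambda>k. rpoly (path_poly k) z"
    have P: "?P k > 0" "?P (Suc k) > 0" "?P k < ?P (Suc k)"
      using path_poly_increasing[OF that, of k] by linarith+
    have "?P (Suc (Suc k)) = ?P (Suc k) * (z - ?P k / ?P (Suc k))"
      using P by (simp add: rpoly_hom right_diff_distrib)
    moreover have "?P k / ?P (Suc k) < 1" using P by simp
    then have "z - ?P k / ?P (Suc k) > 0" using that by linarith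
    ultimately show ?thesis using P by simp
  qed
  show ?case using rec[of x] rec[of y] Suc assms by (auto intro!: frac_le)
qed

text \<open>Beyond 2 the polynomial is \<open>N * M\<close>, where \<open>N\<close> is at least 1
  and \<open>M\<close> increases with slope at least 1. A linear lower bound after a zero yields
  both uniqueness and simplicity of that zero.\<close>

lemma tree_poly_growth:
  assumes "2 < x" "x < y" "rpoly (tree_poly (Suc (Suc k))) x = 0"
  shows "y - x \<le> rpoly (tree_poly (Suc (Suc k))) y"
proof -
  define N where "N z = z * (z ^ 2 - 1) * rpoly (path_poly (Suc k)) z" for z
  define c where "c z = rpoly (path_poly k) z / rpoly (path_poly (Suc k)) z" for z
  define M where "M z = z - 1 / z - 1 / 2 * (1 / (z - 1)) - 1 / 2 * (1 / (z + 1)) - c z" for z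
  have N: "N z \<ge> 1" if "z > 2" for z
  proof -
    have "1 * 1 \<le> z * (z ^ 2 - 1)"
      using that mult_mono[of 2 z 2 z] by (intro mult_mono) (auto simp: power2_eq_square)
    then have "1 * 1 \<le> N z" unfolding N_def
      using path_poly_increasing[OF that, of "Suc k"] by (intro mult_mono) auto
    then show ?thesis by simp
  qed
  have F: "rpoly (tree_poly (Suc (Suc k))) z = N z * M z" if "z > 2" for z
  proof -
    have P: "rpoly (path_poly (Suc k)) z \<noteq> 0" using path_poly_increasing[OF that, of "Suc k"] by linarith
    have z: "z \<noteq> 0" "z \<noteq> 1" "z \<noteq> -1" "z ^ 2 - 1 \<noteq> 0" using that by (auto simp: power2_eq_1_iff)
    have "rpoly (tree_poly (Suc (Suc k))) z
      = (z ^ 4 - 3 * z ^ 2 + 1) * rpoly (path_poly (Suc k)) z - z * (z ^ 2 - 1) * rpoly (path_poly k) z"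
      unfolding tree_poly_eq rpoly_hom path_poly_2 path_poly_4
      by (simp add: eval_nat_numeral algebra_simps)
    also have "\<dots> = N z * ((z ^ 4 - 3 * z ^ 2 + 1) / (z * (z ^ 2 - 1)) - c z)"
      using P z by (simp add: N_def c_def right_diff_distrib)
    finally show ?thesis unfolding M_def partial_fractions[OF z(1-3)] .
  qed
  have "M x = 0" using F[of x] N[of x] assms by auto
  have "M y \<ge> M x + (y - x)"
  proof -
    have "1 / y \<le> 1 / x" "1 / (y - 1) \<le> 1 / (x - 1)" "1 / (y + 1) \<le> 1 / (x + 1)"
      using assms by (auto intro!: frac_le)
    moreover have "c y \<le> c x" unfolding c_def using assms by (intro path_poly_ratio_antimono) auto
    ultimately show ?thesis unfolding M_def by linarith
  qed
  then have "1 * (y - x) \<le> N y * M y"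
    using N[of y] \<open>M x = 0\<close> assms by (intro mult_mono) auto
  then show ?thesis using F[of y] assms by simp
qed

lemma tree_poly_large_roots_eq:
  assumes "rpoly (tree_poly (Suc (Suc k))) x = 0" "x > 2" "rpoly (tree_poly (Suc (Suc k))) y = 0" "y > 2"
  shows "x = y"
  using tree_poly_growth[of x y k] tree_poly_growth[of y x k] assms
  by (cases x y rule: linorder_cases) auto

text \<open>The two zeros coincide, so the derivative of the product vanishes there, whereas
  difference quotients from the right are at least 1.\<close>

lemma tree_poly_large_root_simple:
  assumes F: "tree_poly (Suc (Suc k)) = p * q"
    and p: "rpoly p x = 0" "x > 2" and q: "rpoly q y = 0" "y > 2"
  shows False
proof -
  let ?F = "tree_poly (Suc (Suc k))"
  have root: "rpoly ?F x = 0" "rpoly ?F y = 0" using assms unfolding F rpoly_hom by auto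
  have "x = y" using tree_poly_large_roots_eq root p(2) q(2) by blast
  let ?f = "map_poly real_of_int ?F"
  have "pderiv ?f = map_poly of_int p * pderiv (map_poly of_int q) + map_poly of_int q * pderiv (map_poly of_int p)"
    unfolding F of_int_poly_hom.hom_mult pderiv_mult ..
  then have "poly (pderiv ?f) x = 0" using p(1) q(1) \<open>x = y\<close> by simp
  then have "((\<lambda>y. poly ?f y) has_field_derivative 0) (at x)"
    using poly_DERIV[of ?f x] by simp
  then have "((\<lambda>y. (poly ?f y - poly ?f x) / (y - x)) \<longlongrightarrow> 0) (at x)"
    unfolding has_field_derivative_iff .
  then have "((\<lambda>y. (poly ?f y - poly ?f x) / (y - x)) \<longlongrightarrow> 0) (at_right x)"
    by (rule tendsto_within_subset) simp
  moreover have "eventually (\<lambda>y. 1 \<le> (poly ?f y - poly ?f x) / (y - x)) (at_right x)"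
    using eventually_at_right_less[of x]
  proof eventually_elim
    case (elim y)
    then show ?case
      using tree_poly_growth[OF p(2) elim root(1)] root(1) by (simp add: field_simps)
  qed
  ultimately have "1 \<le> (0::real)"
    by (intro tendsto_lowerbound) auto
  then show False by simp
qed

section \<open>Irreducibility\<close>

text \<open>A product \<open>\<plusminus> p(x) p(-x)\<close> has second and fourth coefficients \<open>2a\<^sub>2 - a\<^sub>1\<^sup>2\<close> and
  \<open>a\<^sub>2\<^sup>2 - 2a\<^sub>1a\<^sub>3 + 2a\<^sub>4\<close>; if the first is \<open>1 - 2m\<close> then \<open>a\<^sub>2 \<equiv> 1 - m\<close> modulo 4.\<close>

lemma coeffs_not_times_reflection:
  fixes p F :: "int poly"
  assumes F: "F = smult c (p * pcompose p [:0, -1:])" and c: "c * c = 1" and p: "monic p"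
    and deg: "degree F = 2 * m" "m \<ge> 2" and mon: "monic F"
    and f2: "coeff F (2 * m - 2) = 1 - 2 * int m"
    and f4: "2 * coeff F (2 * m - 4) = (2 * int m - 1) * (2 * int m - 4)"
  shows False
proof -
  define B where "B = smult c (pcompose p [:0, -1:])"
  have "c \<noteq> 0" using c by auto
  have FB: "F = p * B" unfolding F B_def by simp
  have p0: "p \<noteq> 0" using p by auto
  have dB: "degree B = degree p"
    unfolding B_def using \<open>c \<noteq> 0\<close> by simp
  have "B \<noteq> 0" using mon FB by auto
  have "degree p = m"
    using deg(1) dB degree_mult_eq[OF p0 \<open>B \<noteq> 0\<close>] unfolding FB by simp
  \<comment> \<open>Coefficients are numbered from the top, so that \<open>a i\<close> belongs to
    \<open>x ^ (m - i)\<close>.\<close>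
  define a where "a i = coeff (reflect_poly p) i" for i
  define b where "b i = coeff (reflect_poly B) i" for i
  define s where "s = c * (-1) ^ m"
  have b: "b i = s * (-1) ^ i * a i" for i
  proof (cases "i \<le> m")
    case True
    have "(-1::int) ^ (m - i) = (-1) ^ m * (-1) ^ i"
      using True by (simp add: minus_one_power_iff)
    then show ?thesis using True \<open>degree p = m\<close> dB
      by (simp add: a_def b_def coeff_reflect_poly B_def s_def coeff_pcompose_linear)
  next
    case False
    then show ?thesis using \<open>degree p = m\<close> dB by (simp add: a_def b_def coeff_reflect_poly)
  qed
  have a0: "a 0 = 1" using p by (simp add: a_def)
  have f: "coeff F (2 * m - i) = (\<Sum>j\<le>i. a j * b (i - j))" if "i \<le> 2 * m" for i
  proof -
    have "coeff F (2 * m - i) = coeff (reflect_poly F) i"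
      using that deg(1) by (simp add: coeff_reflect_poly)
    then show ?thesis unfolding FB reflect_poly_mult coeff_mult a_def b_def .
  qed
  have "s = 1" using f[of 0] mon deg(1) a0 b[of 0] by simp
  have e2: "1 - 2 * int m = 2 * a 2 - (a 1) ^ 2"
    using f[of 2] f2 deg(2) a0 unfolding b \<open>s = 1\<close>
    by (simp add: eval_nat_numeral algebra_simps)
  have e4: "(2 * int m - 1) * (2 * int m - 4) = 2 * (2 * a 4 - 2 * a 1 * a 3 + (a 2) ^ 2)"
    using f[of 4] f4 deg(2) a0 unfolding b \<open>s = 1\<close>
    by (simp add: eval_nat_numeral algebra_simps)
  have "(a 1) ^ 2 = 2 * (a 2 + int m - 1) + 1" using e2 by simp
  then have "odd ((a 1) ^ 2)" by simp
  then obtain t where t: "a 1 = 2 * t + 1" by (metis oddE even_power zero_less_numeral)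
  have "2 * a 2 = 2 * (1 - int m + 2 * (t * (t + 1)))"
    using e2 unfolding t by (simp add: power2_eq_square algebra_simps)
  then have a2: "a 2 = 1 - int m + 2 * (t * (t + 1))" by simp
  \<comment> \<open>Modulo 2 this says that \<open>a 2\<close> and \<open>m\<close> have equal
    parity, but \<open>a 2\<close> is congruent to \<open>1 - m\<close>.\<close>
  have "(2 * int m - 1) * (int m - 2) = 2 * a 4 - 2 * a 1 * a 3 + (a 2) ^ 2"
    using e4 by (simp add: algebra_simps)
  then have "even (int m) \<longleftrightarrow> even (a 2)"
    by (metis (no_types, opaque_lifting) even_diff even_mult_iff even_power even_add odd_one dvd_triv_left zero_less_numeral)
  then show False unfolding a2 by simp
qed

lemma unit_circle_of_real:
  assumes "\<bar>x\<bar> \<le> 2"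
  shows "\<exists>z. cmod z = 1 \<and> of_real x = z + 1 / z"
proof -
  define z where "z = cis (arccos (x / 2))"
  have "z + 1 / z = cis (arccos (x / 2)) + cis (- arccos (x / 2))"
    by (simp add: z_def cis_divide[of 0, simplified])
  also have "\<dots> = of_real x"
    using assms by (simp add: complex_eq_iff cos_arccos)
  finally show ?thesis by (intro exI[of _ z]) (simp add: z_def)
qed

lemma monic_without_root_eq_1:
  fixes s :: "int poly"
  assumes "monic s" "\<nexists>x. cpoly s x = 0"
  shows "s = 1"
  using exists_complex_root[of s] assms monic_degree_0[of s] by auto

context
  fixes n :: nat
  assumes n: "n > 8" "even n" "\<not> 3 dvd n" "n mod 5 \<noteq> 4" "n mod 30 \<noteq> 8"
begin

text \<open>If all zeros lay in \<open>[-2, 2]\<close>, they would be \<open>z + 1 / z\<close> with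
  \<open>z\<close> on the unit circle; Kronecker's theorem makes \<open>z\<close> a root of unity,
  and \<open>z ^ 2\<close> is then a forbidden zero of the Coxeter polynomial.\<close>

lemma factor_has_large_root:
  assumes "monic p" "irreducible\<^sub>d p" "p dvd tree_poly (n - 3)"
  shows "\<exists>x. rpoly p x = 0 \<and> \<bar>x\<bar> > 2"
proof (rule ccontr)
  assume no: "\<nexists>x. rpoly p x = 0 \<and> \<bar>x\<bar> > 2"
  have nn: "n - 3 = Suc (Suc (n - 5))" using n(1) by simp
  have root: "cpoly (tree_poly (n - 3)) x = 0" if "cpoly p x = 0" for x
    using assms(3) that by (auto simp: cpoly_hom elim!: dvdE)
  have circ: "\<exists>z. cmod z = 1 \<and> x = z + 1 / z" if "cpoly p x = 0" for x
  proof -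
    have "Im x = 0" using tree_poly_real_rooted root[OF that] unfolding nn by blast
    then have x: "x = of_real (Re x)" by (simp add: complex_eq_iff)
    with that have "rpoly p (Re x) = 0" by (metis cpoly_of_real of_real_eq_0_iff)
    then show ?thesis using no unit_circle_of_real[of "Re x"] x by (metis not_le)
  qed
  obtain x where x: "cpoly p x = 0" using exists_complex_root[of p] irreducible\<^sub>dD(1)[OF assms(2)] by blast
  then obtain z where z: "cmod z = 1" "x = z + 1 / z" using circ by blast
  then have "z \<noteq> 0" by auto
  obtain N where N: "N > 0" "z ^ N = 1"
    using kronecker_unit_circle[OF assms(2,1) circ \<open>z \<noteq> 0\<close>] x z(2) by blast
  \<comment> \<open>The zero \<open>w = 1\<close> of \<open>coxeter_poly\<close> is spurious and
    must be excluded: it would put \<open>x\<close> at 2 or -2, hence \<open>n = 9\<close>, which is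
    odd.\<close>
  have "z ^ 2 \<noteq> 1"
  proof
    assume "z ^ 2 = 1"
    then have "x = 2 \<or> x = - 2" unfolding z(2) power2_eq_1_iff by auto
    then have "cpoly (tree_poly (n - 3)) 2 = 0" using root[OF x] tree_poly_minus[of "n - 3" 2] by auto
    then have "of_nat (n - 3) = (6 :: complex)" unfolding tree_poly_at_2 by simp
    then have "n - 3 = 6" by (metis of_nat_eq_iff of_nat_numeral)
    then show False using n(2) by presburger
  qed
  moreover have "cpoly (coxeter_poly n) (z ^ 2) = 0"
    using tree_poly_joukowski[OF \<open>z \<noteq> 0\<close>, of "n - 3"] root[OF x] n(1) unfolding z(2) by simp
  moreover have "(z ^ 2) ^ N = 1" using N(2) by (metis power_commutes power_mult power_one mult.commute)
  ultimately show False
    using coxeter_root_not_root_of_unity[OF n _ N(1)] unfolding cpoly_coxeter by blast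
qed

text \<open>Each irreducible factor uses up a zero of modulus above 2, and there is room for only
  one of each sign. A second factor is therefore the reflection of the first.\<close>

lemma tree_poly_irreducible: "irreducible\<^sub>d (tree_poly (n - 3))"
proof -
  let ?F = "tree_poly (n - 3)"
  have nn: "n - 3 = Suc (Suc (n - 5))" using n(1) by simp
  have F: "degree ?F = n" "monic ?F" "coeff ?F (n - 2) = - int (n - 1)"
    "2 * coeff ?F (n - 4) = int ((n - 1) * (n - 4))"
    using tree_poly_leading_coeffs[of "n - 5"] n(1) by (auto simp: numeral_eq_Suc Suc_diff_Suc)
  have F4: "2 * coeff ?F (n - 4) = (int n - 1) * (int n - 4)"
    unfolding F(4) using n(1) by (simp add: of_nat_diff)
  have even: "rpoly ?F (- x) = rpoly ?F x" for x
  proof -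
    have "even (n - 3 + 3)" using n(1,2) by simp
    then have "cpoly ?F (- of_real x) = cpoly ?F (of_real x)"
      unfolding tree_poly_minus by simp
    then show ?thesis by (metis cpoly_of_real of_real_eq_iff of_real_minus)
  qed
  note big = factor_has_large_root
  have irr_factor: "\<exists>r. monic r \<and> irreducible\<^sub>d r \<and> r dvd f" if "monic f" "f \<noteq> 1" for f :: "int poly"
    using monic_without_root_eq_1 exists_monic_irreducible_factor that by blast
  have pos: False if "?F = p * q" "rpoly p x = 0" "x > 2" "rpoly q y = 0" "y > 2" for p q x y
    using tree_poly_large_root_simple that unfolding nn by blast
  define rf where "rf p = pcompose p [:0, -1 :: int:]" for p
  have rf: "rpoly (rf p) x = rpoly p (- x)" for p x
    by (induction p) (simp_all add: rf_def pcompose_pCons rpoly_hom of_int_poly_hom.hom_add)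
  have rfc: "cpoly (rf p) x = cpoly p (- x)" for p x
    by (induction p) (simp_all add: rf_def pcompose_pCons cpoly_hom cpoly_pCons)
  \<comment> \<open>Evenness allows the whole factorisation to be reflected, which moves zeros below
    -2 to zeros above 2.\<close>
  have neg: False if "?F = p * q" "rpoly p x = 0" "x < -2" "rpoly q y = 0" "y < -2" for p q x y
  proof -
    have "poly (map_poly real_of_int (rf ?F)) = poly (map_poly of_int ?F)"
      using even by (intro ext) (simp add: rf)
    then have "rf ?F = ?F" by (simp add: poly_eq_poly_eq_iff)
    then have "?F = rf p * rf q" unfolding that(1) rf_def by (simp add: pcompose_mult)
    then show False using pos[of "rf p" "rf q" "- x" "- y"] that by (simp add: rf)
  qed
  have same: False if "?F = p * q" "rpoly p x = 0" "\<bar>x\<bar> > 2" "rpoly q y = 0" "\<bar>y\<bar> > 2" "x * y > 0" for p q x y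
  proof (cases "x > 0")
    case True
    then have "y > 0" using that(6) by (simp add: zero_less_mult_iff)
    then show False using pos[OF that(1,2) _ that(4)] True that(3,5) by simp
  next
    case False
    then have "x < 0" "y < 0" using that(6) by (auto simp: zero_less_mult_iff)
    then show False using neg[OF that(1,2) _ that(4)] that(3,5) by simp
  qed
  obtain p where p: "monic p" "irreducible\<^sub>d p" "p dvd ?F"
    using irr_factor[OF F(2)] F(1) n(1) by fastforce
  then obtain q where q: "?F = p * q" by blast
  have "monic q" using monic_int_monic_cofactor[OF p(1)] F(2) q by simp
  have "q = 1"
  proof (rule ccontr)
    assume "q \<noteq> 1"
    then obtain r where r: "monic r" "irreducible\<^sub>d r" "r dvd q"
      using irr_factor[OF \<open>monic q\<close>] by blast
    then obtain s where s: "q = r * s" by blast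
    have "monic s" using monic_int_monic_cofactor[OF r(1)] \<open>monic q\<close> s by simp
    have Fs: "?F = p * r * s" using q s by (simp add: mult.assoc)
    obtain x where x: "rpoly p x = 0" "\<bar>x\<bar> > 2" using big[OF p] by blast
    have "r dvd ?F" unfolding Fs by simp
    then obtain y where y: "rpoly r y = 0" "\<bar>y\<bar> > 2" using big[OF r(1,2)] by blast
    have "x \<noteq> 0" "y \<noteq> 0" using x y by auto
    have "\<not> x * y > 0"
      using same[of p "r * s" x y] Fs x y by (auto simp: mult.assoc rpoly_hom)
    then have "x * y < 0" using \<open>x \<noteq> 0\<close> \<open>y \<noteq> 0\<close> by (simp add: not_less order_le_less)
    have "s = 1"
    proof (rule ccontr)
      assume "s \<noteq> 1"
      then obtain v where v: "monic v" "irreducible\<^sub>d v" "v dvd s"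
        using irr_factor[OF \<open>monic s\<close>] by blast
      then have "v dvd ?F" unfolding Fs by simp
      then obtain z where z: "rpoly v z = 0" "\<bar>z\<bar> > 2" using big[OF v(1,2)] by blast
      have sz: "rpoly s z = 0" using v(3) z(1) by (auto simp: rpoly_hom elim!: dvdE)
      \<comment> \<open>As \<open>x\<close> and \<open>y\<close> have opposite signs, a third zero
        shares its sign with one of them.\<close>
      consider "x * z > 0" | "y * z > 0"
        using \<open>x * y < 0\<close> z(2) by (auto simp: mult_less_0_iff zero_less_mult_iff abs_if split: if_splits)
      then show False
      proof cases
        case 1
        show False using same[of p "r * s" x z] Fs x z(2) sz 1 by (auto simp: mult.assoc rpoly_hom)
      next
        case 2
        show False using same[of r "p * s" y z] Fs y z(2) sz 2 by (auto simp: mult_ac rpoly_hom)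
      qed
    qed
    have Fx: "rpoly ?F x = 0" "rpoly ?F y = 0" unfolding Fs rpoly_hom using x y by auto
    have "rpoly ?F \<bar>x\<bar> = 0" "rpoly ?F \<bar>y\<bar> = 0"
      using Fx even[of x] even[of y] by (auto simp: abs_if)
    then have "\<bar>x\<bar> = \<bar>y\<bar>" using tree_poly_large_roots_eq x(2) y(2) unfolding nn by blast
    then have xy: "y = - x" using \<open>x * y < 0\<close> by (auto simp: abs_if mult_less_0_iff split: if_splits)
    have cx: "cpoly p (of_real x) = 0" "cpoly r (of_real y) = 0"
      using x(1) y(1) by (simp_all add: cpoly_of_real)
    \<comment> \<open>Since \<open>y = - x\<close>, each factor shares a zero with the reflection of
      the other. The divisibilities force equal degrees, leaving only a constant \<open>c\<close>,
      which is a sign.\<close>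
    have "p dvd rf r"
      by (rule dvd_if_common_root[OF p(2,1) cx(1)]) (use cx xy in \<open>simp add: rfc\<close>)
    have "r dvd rf p"
      by (rule dvd_if_common_root[OF r(2,1) cx(2)]) (use cx xy in \<open>simp add: rfc\<close>)
    then obtain t where t: "rf p = r * t" by blast
    have nz: "p \<noteq> 0" "r \<noteq> 0" using p r by auto
    have drf: "degree (rf f) = degree f" for f by (simp add: rf_def)
    then have "rf p \<noteq> 0" "rf r \<noteq> 0"
      using irreducible\<^sub>dD(1)[OF p(2)] irreducible\<^sub>dD(1)[OF r(2)] by (metis degree_0 less_irrefl)+
    then have "degree p \<le> degree r" "t \<noteq> 0"
      using dvd_imp_degree_le[OF \<open>p dvd rf r\<close>] drf t by auto
    moreover have "degree p = degree r + degree t"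
      using drf[of p] degree_mult_eq[OF nz(2) \<open>t \<noteq> 0\<close>] unfolding t by simp
    ultimately have "degree t = 0" by simp
    then obtain c where c: "t = [:c:]" by (rule degree_eq_zeroE)
    have "lead_coeff (rf p) = (- 1) ^ degree p"
      unfolding rf_def using p(1) by (subst lead_coeff_comp) auto
    then have "c = (- 1) ^ degree p" using r(1) \<open>t \<noteq> 0\<close> unfolding t c by (simp add: lead_coeff_mult)
    then have c1: "c * c = 1" by (simp flip: power_add)
    have "smult c (rf p) = r" unfolding t c using c1 by simp
    then have Frf: "?F = smult c (p * pcompose p [:0, -1:])"
      unfolding Fs \<open>s = 1\<close> rf_def by (metis mult.right_neutral mult_smult_right)
    obtain m where m: "n = 2 * m" using n(2) by blast
    show False
      by (rule coeffs_not_times_reflection[OF Frf c1 p(1), of m])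
        (use F(1-3) F4 m n(1) in \<open>auto simp: of_nat_diff\<close>)
  qed
  then show ?thesis using p(2) q by simp
qed

end

section \<open>Determinants\<close>

text \<open>Row \<open>i\<close> has at most two nonzero entries. After expansion along it, the
  off-diagonal minor has a single possibly nonzero entry in the column that was \<open>i\<close>,
  and the two cofactor signs multiply to -1.\<close>

lemma det_leaf_expansion:
  fixes M :: "'a::comm_ring_1 mat"
  assumes M: "M \<in> carrier_mat n n" and ij: "j < i" "i < n"
    and row: "\<And>c. c < n \<Longrightarrow> c \<noteq> i \<Longrightarrow> c \<noteq> j \<Longrightarrow> M $$ (i, c) = 0"
    and col: "\<And>r. r < n \<Longrightarrow> r \<noteq> i \<Longrightarrow> r \<noteq> j \<Longrightarrow> M $$ (r, i) = 0"
  shows "det M = M $$ (i, i) * det (mat_delete M i i)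
    - M $$ (i, j) * M $$ (j, i) * det (mat_delete (mat_delete M i i) j j)"
proof -
  define D where "D = mat_delete M i j"
  have D: "D \<in> carrier_mat (n - 1) (n - 1)" unfolding D_def by (rule mat_delete_carrier[OF M])
  have dim: "dim_row M = n" "dim_col M = n" using M by auto
  have "det M = (\<Sum>c<n. M $$ (i, c) * cofactor M i c)"
    by (rule laplace_expansion_row[OF M ij(2)])
  also have "\<dots> = (\<Sum>c\<in>{i, j}. M $$ (i, c) * cofactor M i c)"
    using ij row by (intro sum.mono_neutral_right) auto
  also have "\<dots> = M $$ (i, i) * cofactor M i i + M $$ (i, j) * cofactor M i j"
    using ij by simp
  finally have 1: "det M = \<dots>" .
  \<comment> \<open>Deleting column \<open>j < i\<close> shifts column \<open>i\<close> to
    \<open>i - 1\<close>; row \<open>j\<close> keeps its index.\<close>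
  have D_col: "D $$ (r, i - 1) = (if r = j then M $$ (j, i) else 0)" if "r < n - 1" for r
  proof -
    have "D $$ (r, i - 1) = M $$ (if r < i then r else Suc r, i)"
    proof -
      have "\<not> i - 1 < j" "Suc (i - 1) = i" "i - 1 < n - 1" using ij by auto
      then show ?thesis using that by (simp add: D_def mat_delete_def dim)
    qed
    then show ?thesis using that ij col[of r] col[of "Suc r"] by auto
  qed
  have "det D = (\<Sum>r<n-1. D $$ (r, i - 1) * cofactor D r (i - 1))"
    by (rule laplace_expansion_column[OF D]) (use ij in auto)
  also have "\<dots> = (\<Sum>r<n-1. if r = j then M $$ (j, i) * cofactor D j (i - 1) else 0)"
    using D_col by (intro sum.cong) auto
  also have "\<dots> = M $$ (j, i) * cofactor D j (i - 1)"
    using ij by (simp add: sum.delta)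
  finally have 2: "det D = \<dots>" .
  have 3: "mat_delete D j (i - 1) = mat_delete (mat_delete M i i) j j"
    using ij by (intro eq_matI) (auto simp: D_def mat_delete_def dim)
  have "(- 1 :: 'a) ^ (i + j) * (- 1) ^ (j + (i - 1)) = - 1"
  proof -
    define m where "m = j + (i - 1)"
    have im: "i + j = Suc m" using ij by (simp add: m_def)
    show ?thesis unfolding im m_def[symmetric] by (simp flip: power_add)
  qed
  then have "cofactor M i j = - (M $$ (j, i) * det (mat_delete (mat_delete M i i) j j))"
    unfolding cofactor_def D_def[symmetric] 2 3
    by (metis (no_types, lifting) mult.assoc mult.left_commute mult_minus1)
  then show ?thesis unfolding 1 by (simp add: cofactor_def algebra_simps)
qed

text \<open>The characteristic matrix \<open>x I - A\<close>. Adjacency is a predicate on indices,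
  so deleting a vertex becomes a relabelling by \<open>insert_index\<close>.\<close>

definition edge_mat :: "nat \<Rightarrow> (nat \<Rightarrow> nat \<Rightarrow> bool) \<Rightarrow> rat poly mat" where
  "edge_mat n E = mat n n (\<lambda>(i, j). if i = j then [:0, 1:] else if E i j then - 1 else 0)"

definition path_edge :: "nat \<Rightarrow> nat \<Rightarrow> bool" where
  "path_edge i j \<longleftrightarrow> j = i + 1 \<or> i = j + 1"

text \<open>Indices are vertex labels minus 1: 2 stands for vertex 3 and \<open>n - 1\<close> for
  the extra leaf.\<close>

definition tree_edge :: "nat \<Rightarrow> nat \<Rightarrow> nat \<Rightarrow> bool" where
  "tree_edge n i j \<longleftrightarrow> i < n - 1 \<and> j < n - 1 \<and> path_edge i j \<or> i = 2 \<and> j = n - 1 \<or> i = n - 1 \<and> j = 2"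

lemma edge_mat_delete:
  assumes "i < Suc n" "r < n" "c < n"
  shows "edge_mat (Suc n) E $$ (insert_index i r, insert_index i c)
    = (if r = c then [:0, 1:] else if E (insert_index i r) (insert_index i c) then - 1 else 0)"
proof -
  have "insert_index i r < Suc n" "insert_index i c < Suc n" "insert_index i r = insert_index i c \<longleftrightarrow> r = c"
    using assms by (auto simp: insert_index_def)
  then show ?thesis by (simp add: edge_mat_def)
qed

text \<open>\<open>E'\<close> and \<open>E''\<close> describe the graph after removing
  \<open>i\<close> and then \<open>j\<close>. The flag \<open>b\<close> tells whether
  \<open>i\<close> is a leaf at \<open>j\<close> or isolated, in which case the second minor drops
  out.\<close>

lemma det_edge_mat_leaf:
  assumes "j < i" "i < Suc (Suc n)"
    and nb: "\<And>c. c < Suc (Suc n) \<Longrightarrow> c \<noteq> i \<Longrightarrow> E i c = (b \<and> c = j) \<and> E c i = (b \<and> c = j)"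
    and E1: "\<And>r c. r < Suc n \<Longrightarrow> c < Suc n \<Longrightarrow> r \<noteq> c \<Longrightarrow> E (insert_index i r) (insert_index i c) = E' r c"
    and E2: "\<And>r c. r < n \<Longrightarrow> c < n \<Longrightarrow> r \<noteq> c \<Longrightarrow> E' (insert_index j r) (insert_index j c) = E'' r c"
  shows "det (edge_mat (Suc (Suc n)) E) = [:0, 1:] * det (edge_mat (Suc n) E')
    - (if b then det (edge_mat n E'') else 0)"
proof -
  let ?M = "edge_mat (Suc (Suc n)) E"
  have M: "?M \<in> carrier_mat (Suc (Suc n)) (Suc (Suc n))" by (simp add: edge_mat_def)
  have 1: "mat_delete ?M i i = edge_mat (Suc n) E'"
  proof (intro eq_matI)
    fix r c assume "r < dim_row (edge_mat (Suc n) E')" "c < dim_col (edge_mat (Suc n) E')"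
    then have rc: "r < Suc n" "c < Suc n" by (simp_all add: edge_mat_def)
    have "mat_delete ?M i i $$ (r, c) = ?M $$ (insert_index i r, insert_index i c)"
      by (rule mat_delete_index[OF M assms(2,2) rc, symmetric])
    then show "mat_delete ?M i i $$ (r, c) = edge_mat (Suc n) E' $$ (r, c)"
      using E1[OF rc] edge_mat_delete[OF assms(2) rc, of E] rc by (simp add: edge_mat_def)
  qed (simp_all add: edge_mat_def)
  have M': "edge_mat (Suc n) E' \<in> carrier_mat (Suc n) (Suc n)" by (simp add: edge_mat_def)
  have j: "j < Suc n" using assms(1,2) by simp
  have 2: "mat_delete (edge_mat (Suc n) E') j j = edge_mat n E''"
  proof (intro eq_matI)
    fix r c assume "r < dim_row (edge_mat n E'')" "c < dim_col (edge_mat n E'')"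
    then have rc: "r < n" "c < n" by (simp_all add: edge_mat_def)
    have "mat_delete (edge_mat (Suc n) E') j j $$ (r, c) = edge_mat (Suc n) E' $$ (insert_index j r, insert_index j c)"
      by (rule mat_delete_index[OF M' j j rc, symmetric])
    then show "mat_delete (edge_mat (Suc n) E') j j $$ (r, c) = edge_mat n E'' $$ (r, c)"
      using E2[OF rc] edge_mat_delete[OF j rc, of E'] rc by (simp add: edge_mat_def)
  qed (simp_all add: edge_mat_def)
  have "det ?M = ?M $$ (i, i) * det (mat_delete ?M i i)
    - ?M $$ (i, j) * ?M $$ (j, i) * det (mat_delete (mat_delete ?M i i) j j)"
    by (rule det_leaf_expansion[OF M assms(1,2)]) (use nb assms(2) in \<open>auto simp: edge_mat_def\<close>)
  moreover have "?M $$ (i, i) = [:0, 1:]" "?M $$ (i, j) * ?M $$ (j, i) = (if b then 1 else 0)"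
    using nb[of j] assms(1,2) by (auto simp: edge_mat_def)
  ultimately show ?thesis unfolding 1 2 by simp
qed

abbreviation rat_poly :: "int poly \<Rightarrow> rat poly" where
  "rat_poly \<equiv> map_poly of_int"

lemma rat_poly_recurrence:
  "rat_poly ([:0, 1:] * p) = [:0, 1:] * rat_poly p"
  "rat_poly ([:0, 1:] * p - q) = [:0, 1:] * rat_poly p - rat_poly q"
  by (simp_all add: of_int_poly_hom.hom_minus of_int_hom.map_poly_pCons_hom)

lemma det_path: "det (edge_mat k path_edge) = rat_poly (path_poly k)"
proof (induction k rule: induct_nat_012)
  case 0
  show ?case by (simp add: edge_mat_def)
next
  case 1
  show ?case by (simp add: edge_mat_def det_single)
next
  case (ge2 k)
  have "det (edge_mat (Suc (Suc k)) path_edge)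
      = [:0, 1:] * det (edge_mat (Suc k) path_edge) - (if True then det (edge_mat k path_edge) else 0)"
    by (rule det_edge_mat_leaf[of k "Suc k"]) (auto simp: path_edge_def insert_index_def)
  then show ?case unfolding ge2 path_poly.simps rat_poly_recurrence by simp
qed

lemma det_tree: "det (edge_mat (k + 3) (tree_edge (k + 3))) = rat_poly (tree_poly k)"
proof (induction k rule: induct_nat_012)
  case 0
  \<comment> \<open>At size 3 the extra vertex and its attachment index coincide.
    \<open>edge_mat\<close> ignores the resulting loop, so the vertex is isolated and the flag is
    \<open>False\<close>.\<close>
  have "det (edge_mat (Suc (Suc 1)) (tree_edge 3))
      = [:0, 1:] * det (edge_mat (Suc 1) path_edge) - (if False then det (edge_mat 1 path_edge) else 0)"
    by (rule det_edge_mat_leaf[of 1 2]) (auto simp: tree_edge_def path_edge_def insert_index_def)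
  moreover have "Suc (Suc 1) = 0 + 3" "Suc 1 = 2" "(3::nat) = 0 + 3" by simp_all
  ultimately show ?case
    unfolding tree_poly.simps rat_poly_recurrence det_path by (metis (full_types) diff_zero)
next
  case 1
  have "edge_mat 4 (tree_edge 4) = edge_mat 4 path_edge"
    by (intro eq_matI) (auto simp: edge_mat_def tree_edge_def path_edge_def)
  then show ?case using det_path[of 4] by simp
next
  case (ge2 k)
  \<comment> \<open>The leaf removed is the free end of the path, at index \<open>k + 3\<close>; the
    extra leaf has the last index, which drops by one with each deletion.\<close>
  have "det (edge_mat (Suc (Suc (k + 3))) (tree_edge (k + 5)))
      = [:0, 1:] * det (edge_mat (Suc (k + 3)) (tree_edge (k + 4)))
        - (if True then det (edge_mat (k + 3) (tree_edge (k + 3))) else 0)"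
    by (rule det_edge_mat_leaf[of "k + 2" "k + 3"]) (auto simp: tree_edge_def path_edge_def insert_index_def)
  then show ?case
    using ge2 unfolding tree_poly.simps rat_poly_recurrence by (simp add: add.commute eval_nat_numeral)
qed

lemma parcs_path_with_leaf:
  "(u, v) \<in> parcs (path_with_leaf n k) \<longleftrightarrow>
    1 \<le> u \<and> u + 1 \<le> n - 1 \<and> v = u + 1 \<or> 1 \<le> v \<and> v + 1 \<le> n - 1 \<and> u = v + 1
    \<or> u = k \<and> v = n \<or> u = n \<and> v = k"
  by (auto simp: path_with_leaf_def)

lemma graph_char_poly_path_with_leaf:
  assumes "n \<ge> 4"
  shows "graph_char_poly (path_with_leaf n 3) = rat_poly (tree_poly (n - 3))"
proof -
  let ?G = "path_with_leaf n 3"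
  have vs: "sorted_list_of_set (pverts ?G) = [1..<Suc n]"
    by (simp add: path_with_leaf_def atLeastLessThanSuc_atLeastAtMost[symmetric] del: upt_Suc)
  have edge: "(Suc i, Suc j) \<in> parcs ?G \<longleftrightarrow> tree_edge n i j" if "i < n" "j < n" for i j
    using that assms unfolding parcs_path_with_leaf tree_edge_def path_edge_def by presburger
  have "\<not> tree_edge n i i" for i
    using assms by (auto simp: tree_edge_def path_edge_def)
  moreover have "[:- 1 :: rat:] = - 1" by (rule poly_eqI) (simp add: coeff_pCons split: nat.split)
  ultimately have "char_poly_matrix (adjacency_matrix ?G) = edge_mat n (tree_edge n)"
    unfolding adjacency_matrix_def Let_def vs
    by (intro eq_matI) (simp_all add: char_poly_matrix_def edge_mat_def edge del: upt_Suc)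
  then show ?thesis
    unfolding graph_char_poly_def char_poly_def using det_tree[of "n - 3"] assms by simp
qed

section \<open>The trees\<close>

lemma cas_with_proj_verts:
  "pre_digraph.cas (with_proj G) u p v \<Longrightarrow> pre_digraph.awalk_verts (with_proj G) u p = u # map snd p"
  by (induction p arbitrary: u) (auto simp: pre_digraph.cas.simps pre_digraph.awalk_verts.simps)

lemma cas_with_proj_nth:
  "pre_digraph.cas (with_proj G) u p v \<Longrightarrow> i < length p \<Longrightarrow>
    fst (p ! i) = (if i = 0 then u else snd (p ! (i - 1))) \<and> (Suc i = length p \<longrightarrow> snd (p ! i) = v)"
proof (induction p arbitrary: u i)
  case (Cons e p)
  then show ?case
    by (cases i; cases p) (auto simp: pre_digraph.cas.simps nth_Cons')
qed simp

text \<open>The largest vertex of a cycle has two smaller neighbours.\<close>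

lemma no_cycle_if_unique_smaller_neighbour:
  fixes G :: "'a::linorder pair_pre_digraph"
  assumes "pair_graph G"
    and unique: "\<And>v a b. (a, v) \<in> parcs G \<Longrightarrow> (b, v) \<in> parcs G \<Longrightarrow> a < v \<Longrightarrow> b < v \<Longrightarrow> a = b"
    and cyc: "pre_digraph.cycle (with_proj G) p"
  shows "length p < 3"
proof (rule ccontr)
  assume len: "\<not> length p < 3"
  interpret G: pair_graph G by fact
  define L where "L = length p"
  \<comment> \<open>The heads of the arcs, read cyclically, so that the neighbours of every position
    exist.\<close>
  define a where "a i = snd (p ! (i mod L))" for i
  have L: "L \<ge> 3" using len by (simp add: L_def)
  obtain u where u: "set p \<subseteq> parcs G" "pre_digraph.cas (with_proj G) u p u"
      "distinct (tl (pre_digraph.awalk_verts (with_proj G) u p))"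
    using cyc unfolding pre_digraph.cycle_def pre_digraph.awalk_def by auto
  then have dist: "distinct (map snd p)" using cas_with_proj_verts[OF u(2)] by simp
  have "p \<noteq> []" using L by (auto simp: L_def)
  have inj: "i mod L = j mod L" if "a i = a j" for i j
    using that \<open>p \<noteq> []\<close> nth_eq_iff_index_eq[OF dist, of "i mod L" "j mod L"] by (simp add: a_def L_def)
  have arc: "(a i, a (Suc i)) \<in> parcs G" for i
  proof -
    define j where "j = Suc i mod L"
    have j: "j < L" using L by (simp add: j_def)
    have "fst (p ! j) = a i"
    proof (cases "j = 0")
      case True
      then have "i mod L = L - 1" using L unfolding j_def by (simp add: mod_Suc split: if_splits)
      then show ?thesis
        using True cas_with_proj_nth[OF u(2), of 0] cas_with_proj_nth[OF u(2), of "L - 1"] \<open>p \<noteq> []\<close>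
        by (simp add: a_def L_def)
    next
      case False
      then have "i mod L = j - 1" unfolding j_def by (simp add: mod_Suc split: if_splits)
      then show ?thesis
        using False cas_with_proj_nth[OF u(2), of j] j by (simp add: a_def L_def)
    qed
    moreover have "snd (p ! j) = a (Suc i)" by (simp add: a_def j_def)
    moreover have "p ! j \<in> parcs G" using u(1) j by (auto simp: L_def)
    ultimately show ?thesis by (metis prod.collapse)
  qed
  have "finite (a ` {..<L})" "a ` {..<L} \<noteq> {}" using L by (auto simp: lessThan_empty_iff)
  then obtain m where m: "m < L" "a m = Max (a ` {..<L})"
    using Max_in by (metis (no_types, lifting) imageE lessThan_iff)
  have le: "a i \<le> a m" for i
  proof -
    have "a i = a (i mod L)" by (simp add: a_def)
    moreover have "i mod L < L" using L by simp
    ultimately show ?thesis unfolding m(2) using \<open>finite (a ` {..<L})\<close> by (metis Max_ge imageI lessThan_iff)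
  qed
  have am: "a (m + L) = a m" by (simp add: a_def)
  have next_less: "a (Suc m) < a m"
    using le[of "Suc m"] arc[of m] G.pair_no_loops[of "(a m, a (Suc m))"] by (auto simp: order_le_less)
  have prev_arc: "(a (m + L - 1), a m) \<in> parcs G"
    using arc[of "m + L - 1"] am L by simp
  then have prev_less: "a (m + L - 1) < a m"
    using le[of "m + L - 1"] G.pair_no_loops[of "(a (m + L - 1), a m)"] by (auto simp: order_le_less)
  have "(a (Suc m), a m) \<in> parcs G" using arc[of m] G.arcs_symmetric by blast
  then have "a (m + L - 1) = a (Suc m)" by (rule unique[OF prev_arc _ prev_less next_less])
  \<comment> \<open>The predecessor and the successor of the maximum would be the same position,
    which is impossible on a cycle of length at least 3.\<close>
  then have "(m + L - 1) mod L = Suc m mod L" by (rule inj)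
  then have "L dvd (m + L - 1) - Suc m" using L by (subst mod_eq_dvd_iff_nat[symmetric]) auto
  then have "L dvd L - 2" using L by simp
  then show False using L by (auto dest: dvd_imp_le)
qed

lemma pair_graph_path_with_leaf:
  assumes "n \<ge> 4"
  shows "pair_graph (path_with_leaf n 3)"
proof
  let ?G = "path_with_leaf n 3"
  show "finite (pverts ?G)" by (simp add: path_with_leaf_def)
  show v: "fst e \<in> pverts ?G" if "e \<in> parcs ?G" for e
    using that assms by (cases e) (auto simp: parcs_path_with_leaf, auto simp: path_with_leaf_def)
  show w: "snd e \<in> pverts ?G" if "e \<in> parcs ?G" for e
    using that assms by (cases e) (auto simp: parcs_path_with_leaf, auto simp: path_with_leaf_def)
  have "parcs ?G \<subseteq> pverts ?G \<times> pverts ?G" using v w by (auto simp: mem_Times_iff)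
  then show "finite (parcs ?G)" using \<open>finite (pverts ?G)\<close> by (metis finite_SigmaI finite_subset)
  show "fst e \<noteq> snd e" if "e \<in> parcs ?G" for e
    using that assms by (cases e) (auto simp: parcs_path_with_leaf)
  show "symmetric ?G"
    unfolding symmetric_def by (auto intro!: symI simp: arcs_ends_conv parcs_path_with_leaf)
qed

lemma connected_path_with_leaf:
  assumes "n \<ge> 4"
  shows "Digraph_Component.connected (with_proj (path_with_leaf n 3))"
proof -
  let ?G = "path_with_leaf n 3"
  interpret G: pair_graph ?G by (rule pair_graph_path_with_leaf[OF assms])
  have verts: "pverts ?G = {1..n}" by (simp add: path_with_leaf_def)
  have path: "1 \<rightarrow>\<^sup>*\<^bsub>with_proj ?G\<^esub> v" if "1 \<le> v" "v \<le> n - 1" for v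
    using that
  proof (induction v rule: nat_induct_at_least)
    case base
    then show ?case using assms by (simp add: verts)
  next
    case (Suc v)
    have "(v, Suc v) \<in> parcs ?G" using Suc by (auto simp: parcs_path_with_leaf)
    then show ?case using Suc G.reachable_adj_trans by simp
  qed
  have "(3, n) \<in> parcs ?G" by (simp add: parcs_path_with_leaf)
  then have "1 \<rightarrow>\<^sup>*\<^bsub>with_proj ?G\<^esub> n"
  proof -
    have "3 \<le> n - 1" using assms by simp
    then show ?thesis using path[of 3] \<open>(3, n) \<in> parcs ?G\<close> G.reachable_adj_trans by simp
  qed
  then have reach: "1 \<rightarrow>\<^sup>*\<^bsub>with_proj ?G\<^esub> v" if "v \<in> pverts ?G" for v
    using that path[of v] unfolding verts by (cases "v = n") auto
  have "strongly_connected (with_proj ?G)"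
  proof (rule strongly_connectedI)
    show "verts (with_proj ?G) \<noteq> {}" using assms by (simp add: verts)
    fix u v assume "u \<in> verts (with_proj ?G)" "v \<in> verts (with_proj ?G)"
    then show "u \<rightarrow>\<^sup>*\<^bsub>with_proj ?G\<^esub> v"
      using reach G.symmetric_reachable' G.reachable_trans by (metis with_proj_simps(1))
  qed
  then show ?thesis
    using G.reachable_mk_symmetric_eq[OF G.sym_arcs]
    unfolding connected_def strongly_connected_def by simp
qed

text \<open>In this labelling the only smaller neighbour of a path vertex \<open>v > 1\<close> is
  \<open>v - 1\<close>, and that of the leaf \<open>n\<close> is 3.\<close>

lemma graph_tree_path_with_leaf:
  assumes "n \<ge> 4"
  shows "graph_tree (path_with_leaf n 3)"
proof -
  have "length p < 3" if "pre_digraph.cycle (with_proj (path_with_leaf n 3)) p" for p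
    by (rule no_cycle_if_unique_smaller_neighbour[OF pair_graph_path_with_leaf[OF assms] _ that])
      (use assms in \<open>auto simp: parcs_path_with_leaf\<close>)
  then show ?thesis
    unfolding graph_tree_def using pair_graph_path_with_leaf connected_path_with_leaf assms
    by (metis not_less)
qed

lemma path_with_leaf_not_isomorphic:
  assumes "m \<ge> 4" "n \<ge> 4" "m \<noteq> n"
  shows "\<not> graph_isomorphic (path_with_leaf m 3) (path_with_leaf n 3)"
proof
  interpret M: pair_graph "path_with_leaf m 3" by (rule pair_graph_path_with_leaf[OF assms(1)])
  interpret N: pair_graph "path_with_leaf n 3" by (rule pair_graph_path_with_leaf[OF assms(2)])
  assume "graph_isomorphic (path_with_leaf m 3) (path_with_leaf n 3)"
  then obtain f where "bij_betw f (pverts (path_with_leaf m 3)) (pverts (path_with_leaf n 3))"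
    using graph_isomorphic_iff[OF M.pair_wf_digraph N.pair_wf_digraph] by blast
  then have "card {1..m} = card {1..n}" by (auto simp: path_with_leaf_def dest: bij_betw_same_card)
  then show False using assms(3) by simp
qed

section \<open>Irreducibility over the rationals and the infinite family\<close>

lemma irreducible_graph_char_poly:
  fixes n :: nat
  assumes "n > 8" "n mod 30 \<in> {2, 10, 16, 20, 22, 26, 28}"
  shows "irreducible (graph_char_poly (path_with_leaf n 3))"
proof -
  have "even n" "\<not> 3 dvd n" "n mod 5 \<noteq> 4" "n mod 30 \<noteq> 8"
  proof -
    have "n = 30 * (n div 30) + n mod 30" by simp
    then obtain k r where n: "n = 30 * k + r" "r \<in> {2, 10, 16, 20, 22, 26, 28}" using assms(2) by blast
    then have "r < 30" by auto
    show "even n" "\<not> 3 dvd n" "n mod 5 \<noteq> 4" "n mod 30 \<noteq> 8"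
      using n(2) unfolding n(1) by (elim insertE; simp; presburger)+
  qed
  then have "irreducible\<^sub>d (tree_poly (n - 3))" using tree_poly_irreducible assms(1) by blast
  \<comment> \<open>Gauss's lemma passes from integer factorisations by degree to irreducibility
    over the rationals.\<close>
  then show ?thesis
    using irreducible\<^sub>d_int_rat assms(1) by (simp add: graph_char_poly_path_with_leaf)
qed

theorem theorem1:
  shows "(\<forall>n::nat. n > 8 \<longrightarrow> n mod 30 \<in> {2, 10, 16, 20, 22, 26, 28} \<longrightarrow>
            irreducible (graph_char_poly (path_with_leaf n 3)))
       \<and> (\<exists>\<T> :: nat pair_pre_digraph set.
            infinite \<T> \<and>
            (\<forall>T\<in>\<T>. graph_tree T \<and> irreducible (graph_char_poly T)) \<and>
            pairwise (\<lambda>S T. \<not> graph_isomorphic S T) \<T>)"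
proof (intro conjI allI impI exI)
  \<comment> \<open>The residue class 10 serves as the family, since already its first member
    exceeds 8; the number of vertices separates the members.\<close>
  let ?T = "(\<lambda>k. path_with_leaf (30 * k + 10) 3) ` UNIV"
  have "path_with_leaf (30 * k + 10) 3 \<noteq> path_with_leaf (30 * l + 10) 3" if "k \<noteq> l" for k l
    using arg_cong[of "path_with_leaf (30 * k + 10) 3" "path_with_leaf (30 * l + 10) 3" "\<lambda>G. card (pverts G)"] that
    by (auto simp: path_with_leaf_def)
  then have "inj (\<lambda>k. path_with_leaf (30 * k + 10) 3)" by (auto intro: injI)
  then show "infinite ?T" using finite_imageD by blast
  show "\<forall>T\<in>?T. graph_tree T \<and> irreducible (graph_char_poly T)"
    by (auto intro!: graph_tree_path_with_leaf irreducible_graph_char_poly)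
  show "pairwise (\<lambda>S T. \<not> graph_isomorphic S T) ?T"
  proof (rule pairwiseI)
    fix S T assume "S \<in> ?T" "T \<in> ?T" "S \<noteq> T"
    then obtain k l where "S = path_with_leaf (30 * k + 10) 3" "T = path_with_leaf (30 * l + 10) 3" "k \<noteq> l"
      by blast
    then show "\<not> graph_isomorphic S T" by (simp add: path_with_leaf_not_isomorphic)
  qed
qed (rule irreducible_graph_char_poly)

end
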